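(* Let $R$ be a unital ring and $(E,\omega)$ a row-finite weighted graph. For every vertex $v\in E^0$ which is not a sink fix a structured edge $\alpha^v\in E^{\mathrm{st}}$ with $s(\alpha^v)=v$ and $\omega(\alpha^v)=\omega(v)$. Then the weighted Leavitt path algebra $L_R(E,\omega)$ has a basis (as a left $R$-module) consisting of the normal generalised paths. Namely, the basis elements are (the images in $L_R(E,\omega)$ of) the generalised paths $p$, i.e. the words of the form $p=x_1\cdots x_n$ with $n\ge 1$, $x_i\in E^1\cup(E^1)^*$, $r(x_i)=s(x_{i+1})$ for $1\le i\le n-1$, or $p=x_1$ with $x_1\in E^0$, such that none of the words $\alpha^v_i(\alpha^v_j)^*$ (where $v\in E^0$ is not a sink and $1\le i,j\le\omega(\alpha^v)$) and none of the words $\alpha_1^*\beta_1$ (where $\alpha,\beta\in E^{\mathrm{st}}$) is a subword of $p$.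
   Context: A weighted graph $(E,\omega)$, $E=(E^0,E^{\mathrm{st}},E^1,s,r,\omega)$, consists of countable sets $E^0$ (vertices), $E^{\mathrm{st}}$ (structured edges), $E^1$ (edges), maps $s,r:E^{\mathrm{st}}\to E^0$ and a weight map $\omega:E^{\mathrm{st}}\to\mathbb N=\{1,2,\dots\}$ such that $E^1=\bigsqcup_{\alpha\in E^{\mathrm{st}}}\{\alpha_1,\dots,\alpha_{\omega(\alpha)}\}$ (each $\alpha$ contributes $\omega(\alpha)$ distinct edges). It is row-finite if $s^{-1}(v)\subseteq E^{\mathrm{st}}$ is finite for every $v\in E^0$. A vertex $v$ is a sink if $s^{-1}(v)=\emptyset$; if $v$ is not a sink, $\omega(v):=\max\{\omega(\alpha)\mid\alpha\in s^{-1}(v)\}$. Let $(E^1)^*=\{\alpha_i^*\mid\alpha_i\in E^1\}$ and $X=E^0\cup E^1\cup(E^1)^*$. Let $\langle X\rangle$ be the semigroup of nonempty words over $X$ and $R\langle X\rangle$ the free $R$-ring on $X$: the free left $R$-module with basis $\langle X\rangle$ and multiplication $(\sum r_xx)(\sum s_yy)=\sum r_xs_y\,xy$ (an $R$-ring is a not necessarily unital ring that is an $R$-bimodule with multiplication left linear in the first and right linear in the second argument). The weighted Leavitt path algebra $L_R(E,\omega)$ is the quotient of $R\langle X\rangle$ by the ideal (an $R$-subbimodule) generated by the relations: (1) $vw=\delta_{vw}v$ for $v,w\in E^0$; (2) $s(\alpha)\alpha_i=\alpha_ir(\alpha)=\alpha_i$ and $r(\alpha)\alpha_i^*=\alpha_i^*s(\alpha)=\alpha_i^*$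 for $\alpha\in E^{\mathrm{st}}$, $1\le i\le\omega(\alpha)$; (3) $\sum_{\alpha\in s^{-1}(v)}\alpha_i\alpha_j^*=\delta_{ij}v$ for every non-sink $v\in E^0$ and $1\le i,j\le\omega(v)$; (4) $\sum_{1\le i\le\max\{\omega(\alpha),\omega(\beta)\}}\alpha_i^*\beta_i=\delta_{\alpha\beta}r(\alpha)$ for all $\alpha,\beta\in E^{\mathrm{st}}$; where in (3) and (4) $\alpha_i:=\alpha_i^*:=0$ whenever $i>\omega(\alpha)$. For edges, $s(\alpha_i)=s(\alpha)$, $r(\alpha_i)=r(\alpha)$, $s(\alpha_i^* )=r(\alpha)$, $r(\alpha_i^* )=s(\alpha)$. *)

theory Defs
  imports
    "HOL-Library.Poly_Mapping"
    "HOL-Library.Countable_Set"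
    "HOL-Library.Sublist"
    "HOL-Algebra.QuotRing"
    "HOL-Algebra.Module"
    "Graph_Theory.Digraph"
begin

section \<open>Weighted graphs\<close>

text \<open>
  The structured edges are the arcs of a directed graph, with source \<^const>\<open>tail\<close>, range
  \<^const>\<open>head\<close> and a weight function \<open>\<omega>\<close>. The \<open>i\<close>-th edge belonging to a
  structured edge \<open>\<alpha>\<close>, \<open>1 \<le> i \<le> \<omega> \<alpha>\<close>, is represented by the pair \<open>(\<alpha>, i)\<close>; this makes the set
  of edges the required disjoint union.
\<close>

locale weighted_graph = wf_digraph E for E :: "('v, 'e) pre_digraph" (structure) +
  fixes \<omega> :: "'e \<Rightarrow> nat"
  assumes countable_verts: "countable (verts E)"
    and countable_arcs: "countable (arcs E)"
    and weight_pos: "\<alpha> \<in> arcs E \<Longrightarrow> 1 \<le> \<omega> \<alpha>"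

locale row_finite_weighted_graph = weighted_graph +
  assumes row_finite: "v \<in> verts E \<Longrightarrow> finite (out_arcs E v)"

definition sink :: "('v, 'e) pre_digraph \<Rightarrow> 'v \<Rightarrow> bool" where
  "sink E v \<longleftrightarrow> out_arcs E v = {}"

definition vertex_weight :: "('v, 'e) pre_digraph \<Rightarrow> ('e \<Rightarrow> nat) \<Rightarrow> 'v \<Rightarrow> nat" where
  "vertex_weight E \<omega> v = Max (\<omega> ` out_arcs E v)"

datatype ('v, 'e) letter = Vert 'v | Edge 'e nat | Ghost 'e nat

definition edge_letters :: "('v, 'e) pre_digraph \<Rightarrow> ('e \<Rightarrow> nat) \<Rightarrow> ('v, 'e) letter set" where
  "edge_letters E \<omega> = {Edge \<alpha> i | \<alpha> i. \<alpha> \<in> arcs E \<and> 1 \<le> i \<and> i \<le> \<omega> \<alpha>}"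

definition ghost_letters :: "('v, 'e) pre_digraph \<Rightarrow> ('e \<Rightarrow> nat) \<Rightarrow> ('v, 'e) letter set" where
  "ghost_letters E \<omega> = {Ghost \<alpha> i | \<alpha> i. \<alpha> \<in> arcs E \<and> 1 \<le> i \<and> i \<le> \<omega> \<alpha>}"

definition letters :: "('v, 'e) pre_digraph \<Rightarrow> ('e \<Rightarrow> nat) \<Rightarrow> ('v, 'e) letter set" where
  "letters E \<omega> = Vert ` verts E \<union> edge_letters E \<omega> \<union> ghost_letters E \<omega>"


section \<open>Rings over a not necessarily commutative coefficient ring\<close>

text \<open>
  Algebras over a noncommutative coefficient type carry a left and a right scalar
  multiplication. The library record \<^typ>\<open>('r, 'a) module\<close> is extended by the latter; its
  field \<^const>\<open>one\<close> plays no role, since these rings need not be unital.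
\<close>

record ('r, 'a) bimodule_ring = "('r, 'a) module" +
  rsmult :: "'a \<Rightarrow> 'r \<Rightarrow> 'a"

definition bimodule_ideal :: "('r, 'a) bimodule_ring \<Rightarrow> 'a set \<Rightarrow> bool" where
  "bimodule_ideal A I \<longleftrightarrow>
     additive_subgroup I A \<and>
     (\<forall>x\<in>I. \<forall>r. r \<odot>\<^bsub>A\<^esub> x \<in> I \<and> rsmult A x r \<in> I) \<and>
     (\<forall>x\<in>I. \<forall>a\<in>carrier A. a \<otimes>\<^bsub>A\<^esub> x \<in> I \<and> x \<otimes>\<^bsub>A\<^esub> a \<in> I)"

definition quotient_bimodule_ring ::
    "('r, 'a) bimodule_ring \<Rightarrow> 'a set \<Rightarrow> ('r, 'a set) bimodule_ring" where
  "quotient_bimodule_ring A I =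
     \<lparr>carrier = a_rcosets\<^bsub>A\<^esub> I,
      monoid.mult = rcoset_mult A I,
      one = undefined,
      zero = I,
      add = set_add A,
      smult = (\<lambda>r C. \<Union>x\<in>C. I +>\<^bsub>A\<^esub> (r \<odot>\<^bsub>A\<^esub> x)),
      rsmult = (\<lambda>C r. \<Union>x\<in>C. I +>\<^bsub>A\<^esub> (rsmult A x r))\<rparr>"

text \<open>
  The family \<open>b\<close>, indexed by \<open>S\<close>, is a basis of the left module underlying \<open>M\<close>. Independence
  is that of a family, so over a nonzero ring it includes injectivity of \<open>b\<close> on \<open>S\<close>.
\<close>

definition left_basis ::
    "('r::{ring,monoid_mult}, 'a, 'x) module_scheme \<Rightarrow> 'i set \<Rightarrow> ('i \<Rightarrow> 'a) \<Rightarrow> bool" where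
  "left_basis M S b \<longleftrightarrow>
     b ` S \<subseteq> carrier M \<and>
     (\<forall>m\<in>carrier M. \<exists>T c. finite T \<and> T \<subseteq> S \<and> m = (\<Oplus>\<^bsub>M\<^esub>i\<in>T. c i \<odot>\<^bsub>M\<^esub> b i)) \<and>
     (\<forall>T c. finite T \<and> T \<subseteq> S \<and> (\<Oplus>\<^bsub>M\<^esub>i\<in>T. c i \<odot>\<^bsub>M\<^esub> b i) = \<zero>\<^bsub>M\<^esub>
        \<longrightarrow> (\<forall>i\<in>T. c i = 0))"


section \<open>The free ring on a set of letters\<close>

text \<open>
  Lists are made the free monoid (with concatenation written additively), so that \<open>*\<close> on
  \<^typ>\<open>'x list \<Rightarrow>\<^sub>0 'r\<close> is the convolution product \<open>(\<Sum> r\<^sub>x x) * (\<Sum> s\<^sub>y y) = \<Sum> r\<^sub>x s\<^sub>y xy\<close>.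
\<close>

instantiation list :: (type) monoid_add
begin

definition zero_list :: "'a list" where "zero_list = []"

definition plus_list :: "'a list \<Rightarrow> 'a list \<Rightarrow> 'a list" where "plus_list = (@)"

instance
  by standard (simp_all add: zero_list_def plus_list_def)

end

text \<open>The coefficient sort is that of unital rings, the zero ring included.\<close>

definition free_bimodule_ring ::
    "'x set \<Rightarrow> ('r::{ring,monoid_mult}, 'x list \<Rightarrow>\<^sub>0 'r) bimodule_ring" where
  "free_bimodule_ring X =
     \<lparr>carrier = {f. Poly_Mapping.keys f \<subseteq> {w. w \<noteq> [] \<and> set w \<subseteq> X}},
      monoid.mult = (*),
      one = undefined,
      zero = 0,
      add = (+),
      smult = (\<lambda>r. Poly_Mapping.map (\<lambda>c. r * c)),
      rsmult = (\<lambda>f r. Poly_Mapping.map (\<lambda>c. c * r) f)\<rparr>"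


section \<open>Weighted Leavitt path algebras\<close>

definition word :: "'x list \<Rightarrow> ('x list \<Rightarrow>\<^sub>0 'r::{ring,monoid_mult})" where
  "word w = Poly_Mapping.single w 1"

definition edge ::
    "('e \<Rightarrow> nat) \<Rightarrow> 'e \<Rightarrow> nat \<Rightarrow> (('v, 'e) letter list \<Rightarrow>\<^sub>0 'r::{ring,monoid_mult})" where
  "edge \<omega> \<alpha> i = (if i \<le> \<omega> \<alpha> then word [Edge \<alpha> i] else 0)"

definition ghost ::
    "('e \<Rightarrow> nat) \<Rightarrow> 'e \<Rightarrow> nat \<Rightarrow> (('v, 'e) letter list \<Rightarrow>\<^sub>0 'r::{ring,monoid_mult})" where
  "ghost \<omega> \<alpha> i = (if i \<le> \<omega> \<alpha> then word [Ghost \<alpha> i] else 0)"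

text \<open>A defining relation \<open>f = g\<close> is recorded as the element \<open>f - g\<close>.\<close>

inductive_set wlpa_relations ::
    "('v, 'e) pre_digraph \<Rightarrow> ('e \<Rightarrow> nat) \<Rightarrow> (('v, 'e) letter list \<Rightarrow>\<^sub>0 'r::{ring,monoid_mult}) set"
  for E \<omega> where
  vert_vert: "v \<in> verts E \<Longrightarrow> w \<in> verts E \<Longrightarrow>
    word [Vert v, Vert w] - (if v = w then word [Vert v] else 0) \<in> wlpa_relations E \<omega>"
| source_edge: "\<alpha> \<in> arcs E \<Longrightarrow> 1 \<le> i \<Longrightarrow> i \<le> \<omega> \<alpha> \<Longrightarrow>
    word [Vert (tail E \<alpha>), Edge \<alpha> i] - word [Edge \<alpha> i] \<in> wlpa_relations E \<omega>"
| edge_range: "\<alpha> \<in> arcs E \<Longrightarrow> 1 \<le> i \<Longrightarrow> i \<le> \<omega> \<alpha> \<Longrightarrow>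
    word [Edge \<alpha> i, Vert (head E \<alpha>)] - word [Edge \<alpha> i] \<in> wlpa_relations E \<omega>"
| range_ghost: "\<alpha> \<in> arcs E \<Longrightarrow> 1 \<le> i \<Longrightarrow> i \<le> \<omega> \<alpha> \<Longrightarrow>
    word [Vert (head E \<alpha>), Ghost \<alpha> i] - word [Ghost \<alpha> i] \<in> wlpa_relations E \<omega>"
| ghost_source: "\<alpha> \<in> arcs E \<Longrightarrow> 1 \<le> i \<Longrightarrow> i \<le> \<omega> \<alpha> \<Longrightarrow>
    word [Ghost \<alpha> i, Vert (tail E \<alpha>)] - word [Ghost \<alpha> i] \<in> wlpa_relations E \<omega>"
| edge_ghost: "v \<in> verts E \<Longrightarrow> \<not> sink E v \<Longrightarrow>
    1 \<le> i \<Longrightarrow> i \<le> vertex_weight E \<omega> v \<Longrightarrow> 1 \<le> j \<Longrightarrow> j \<le> vertex_weight E \<omega> v \<Longrightarrow>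
    (\<Sum>\<alpha>\<in>out_arcs E v. edge \<omega> \<alpha> i * ghost \<omega> \<alpha> j) - (if i = j then word [Vert v] else 0)
      \<in> wlpa_relations E \<omega>"
| ghost_edge: "\<alpha> \<in> arcs E \<Longrightarrow> \<beta> \<in> arcs E \<Longrightarrow>
    (\<Sum>i = 1..max (\<omega> \<alpha>) (\<omega> \<beta>). ghost \<omega> \<alpha> i * edge \<omega> \<beta> i)
      - (if \<alpha> = \<beta> then word [Vert (head E \<alpha>)] else 0) \<in> wlpa_relations E \<omega>"

definition wlpa_ideal ::
    "('v, 'e) pre_digraph \<Rightarrow> ('e \<Rightarrow> nat) \<Rightarrow> (('v, 'e) letter list \<Rightarrow>\<^sub>0 'r::{ring,monoid_mult}) set" where
  "wlpa_ideal E \<omega> =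
     bimodule_ideal (free_bimodule_ring (letters E \<omega>)) hull wlpa_relations E \<omega>"

definition wlpa ::
    "('v, 'e) pre_digraph \<Rightarrow> ('e \<Rightarrow> nat) \<Rightarrow>
     ('r::{ring,monoid_mult}, (('v, 'e) letter list \<Rightarrow>\<^sub>0 'r) set) bimodule_ring" where
  "wlpa E \<omega> =
     quotient_bimodule_ring (free_bimodule_ring (letters E \<omega>)) (wlpa_ideal E \<omega>)"

definition wlpa_class ::
    "('v, 'e) pre_digraph \<Rightarrow> ('e \<Rightarrow> nat) \<Rightarrow>
     (('v, 'e) letter list \<Rightarrow>\<^sub>0 'r::{ring,monoid_mult}) \<Rightarrow> (('v, 'e) letter list \<Rightarrow>\<^sub>0 'r) set" where
  "wlpa_class E \<omega> f = wlpa_ideal E \<omega> +>\<^bsub>free_bimodule_ring (letters E \<omega>)\<^esub> f"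


section \<open>Normal generalised paths\<close>

fun letter_source :: "('v, 'e) pre_digraph \<Rightarrow> ('v, 'e) letter \<Rightarrow> 'v" where
  "letter_source E (Vert v) = v"
| "letter_source E (Edge \<alpha> i) = tail E \<alpha>"
| "letter_source E (Ghost \<alpha> i) = head E \<alpha>"

fun letter_range :: "('v, 'e) pre_digraph \<Rightarrow> ('v, 'e) letter \<Rightarrow> 'v" where
  "letter_range E (Vert v) = v"
| "letter_range E (Edge \<alpha> i) = head E \<alpha>"
| "letter_range E (Ghost \<alpha> i) = tail E \<alpha>"

definition generalised_path ::
    "('v, 'e) pre_digraph \<Rightarrow> ('e \<Rightarrow> nat) \<Rightarrow> ('v, 'e) letter list \<Rightarrow> bool" where
  "generalised_path E \<omega> p \<longleftrightarrow>
     (\<exists>v\<in>verts E. p = [Vert v]) \<or>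
     (p \<noteq> [] \<and> set p \<subseteq> edge_letters E \<omega> \<union> ghost_letters E \<omega> \<and>
      (\<forall>k. Suc k < length p \<longrightarrow> letter_range E (p ! k) = letter_source E (p ! Suc k)))"

definition normal_path ::
    "('v, 'e) pre_digraph \<Rightarrow> ('e \<Rightarrow> nat) \<Rightarrow> ('v \<Rightarrow> 'e) \<Rightarrow> ('v, 'e) letter list \<Rightarrow> bool" where
  "normal_path E \<omega> sel p \<longleftrightarrow>
     generalised_path E \<omega> p \<and>
     (\<forall>v\<in>verts E. \<not> sink E v \<longrightarrow>
        (\<forall>i\<in>{1..\<omega> (sel v)}. \<forall>j\<in>{1..\<omega> (sel v)}.
           \<not> sublist [Edge (sel v) i, Ghost (sel v) j] p)) \<and>
     (\<forall>\<alpha>\<in>arcs E. \<forall>\<beta>\<in>arcs E. \<not> sublist [Ghost \<alpha> 1, Edge \<beta> 1] p)"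

end

theory Submission
  imports Defs
begin

text \<open>
  Normal generalised paths are encoded as pairs of a start vertex and the reversed list of their
  edges, so that vertices become empty lists. On the free left module over these pairs
  let every letter act from the right by appending it; if this creates a forbidden subword, the
  last two letters are rewritten by relation (3) or (4). Each of these two relations, solved for
  its forbidden word, produces only normal paths when used on a normal path, so the action is given
  by a closed formula and no confluence argument is needed. The defining relations act as zero,
  hence so does the ideal, while a normal path sends its start vertex to itself: this is linear
  independence. Spanning follows because the same formula computes, modulo the ideal, the product
  of a normal path and a letter.
\<close>

section \<open>Linear extensions over a noncommutative coefficient ring\<close>

text \<open>One contraction suffices because the two kinds of forbidden pairs test complementary
  data: a pair ending in an edge letter is recognised by its indices, a pair ending in a ghost
  letter by its structured edges. Relation (3) changes the edge and keeps the indices, relation (4)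
  changes the index and keeps the edges, so the junction with the preceding letter stays normal.
  Maximality of \<open>\<omega> (sel v)\<close> ensures that every instance of (3) contains a
  forbidden word to solve for. The overlaps of forbidden words have not vanished: they are the cases
  of \<open>sum_edge_ghost\<close> and \<open>sum_ghost_edge\<close> in which the path already ends
  in a letter that contracts, and they are settled by exchanging two sums. The other obstacle is
  noncommutativity of the coefficients. The action is left linear, while the ideal is also closed
  under right scalars. Letters act with integer coefficients, hence central ones;
  \<open>central\<close> records this, so that scalars can be moved past the values of the
  action.\<close>

definition lscale :: "'r::{ring,monoid_mult} \<Rightarrow> ('a \<Rightarrow>\<^sub>0 'r) \<Rightarrow> ('a \<Rightarrow>\<^sub>0 'r)" where
  "lscale r = Poly_Mapping.map (\<lambda>c. r * c)"

definition rscale :: "('a \<Rightarrow>\<^sub>0 'r) \<Rightarrow> 'r::{ring,monoid_mult} \<Rightarrow> ('a \<Rightarrow>\<^sub>0 'r)" where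
  "rscale p r = Poly_Mapping.map (\<lambda>c. c * r) p"

definition lin :: "('a \<Rightarrow> 'b \<Rightarrow>\<^sub>0 'r::{ring,monoid_mult}) \<Rightarrow> ('a \<Rightarrow>\<^sub>0 'r) \<Rightarrow> ('b \<Rightarrow>\<^sub>0 'r)" where
  "lin g p = (\<Sum>k\<in>Poly_Mapping.keys p. lscale (Poly_Mapping.lookup p k) (g k))"

definition central :: "('a \<Rightarrow>\<^sub>0 'r::{ring,monoid_mult}) \<Rightarrow> bool" where
  "central p \<longleftrightarrow> (\<forall>k r. r * Poly_Mapping.lookup p k = Poly_Mapping.lookup p k * r)"

lemma lookup_lscale [simp]: "Poly_Mapping.lookup (lscale r p) k = r * Poly_Mapping.lookup p k"
  by (simp add: lscale_def map.rep_eq when_def)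

lemma lookup_rscale [simp]: "Poly_Mapping.lookup (rscale p r) k = Poly_Mapping.lookup p k * r"
  by (simp add: rscale_def map.rep_eq when_def)

lemma lscale_zero_left [simp]: "lscale 0 p = 0"
  and lscale_zero_right [simp]: "lscale r 0 = 0"
  and lscale_one [simp]: "lscale 1 p = p"
  and lscale_lscale [simp]: "lscale r (lscale s p) = lscale (r * s) p"
  and lscale_add_left: "lscale (r + s) p = lscale r p + lscale s p"
  and lscale_add: "lscale r (p + q) = lscale r p + lscale r q"
  and lscale_diff: "lscale r (p - q) = lscale r p - lscale r q"
  and lscale_uminus: "lscale (- r) p = - lscale r p"
  and lscale_single [simp]: "lscale r (Poly_Mapping.single k c) = Poly_Mapping.single k (r * c)"
  by (auto intro!: poly_mapping_eqI
      simp: lookup_add lookup_minus algebra_simps lookup_single when_def)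

lemma lscale_sum: "lscale r (\<Sum>i\<in>A. f i) = (\<Sum>i\<in>A. lscale r (f i))"
  by (rule poly_mapping_eqI) (simp add: lookup_sum sum_distrib_left)

lemma keys_lscale: "Poly_Mapping.keys (lscale r p) \<subseteq> Poly_Mapping.keys p"
  by (auto simp: in_keys_iff)

lemma keys_rscale: "Poly_Mapping.keys (rscale p r) \<subseteq> Poly_Mapping.keys p"
  by (auto simp: in_keys_iff)

lemma keys_diff_subset:
  fixes p q :: "'a \<Rightarrow>\<^sub>0 'b::ab_group_add"
  shows "Poly_Mapping.keys (p - q) \<subseteq> Poly_Mapping.keys p \<union> Poly_Mapping.keys q"
  by (auto simp: in_keys_iff lookup_minus)

lemma keys_sum_subset: "Poly_Mapping.keys (\<Sum>i\<in>A. f i) \<subseteq> (\<Union>i\<in>A. Poly_Mapping.keys (f i))"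
  by (auto simp: in_keys_iff lookup_sum intro: ccontr sum.neutral)

lemma poly_mapping_expansion:
  "p = (\<Sum>k\<in>Poly_Mapping.keys p. Poly_Mapping.single k (Poly_Mapping.lookup p k))"
  by (rule poly_mapping_eqI) (auto simp: lookup_sum lookup_single when_def in_keys_iff)

lemma lin_superset:
  assumes "finite S" "Poly_Mapping.keys p \<subseteq> S"
  shows "lin g p = (\<Sum>k\<in>S. lscale (Poly_Mapping.lookup p k) (g k))"
  unfolding lin_def using assms
  by (intro sum.mono_neutral_left) (auto simp: in_keys_iff)

lemma lin_zero [simp]: "lin g 0 = 0"
  by (simp add: lin_def)

lemma lin_single [simp]: "lin g (Poly_Mapping.single k c) = lscale c (g k)"
  by (simp add: lin_def)

lemma lin_add: "lin g (p + q) = lin g p + lin g q"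
proof -
  let ?S = "Poly_Mapping.keys p \<union> Poly_Mapping.keys q"
  have "lin g (p + q) = (\<Sum>k\<in>?S. lscale (Poly_Mapping.lookup (p + q) k) (g k))"
    by (rule lin_superset) (simp_all add: Poly_Mapping.keys_add)
  also have "\<dots> = (\<Sum>k\<in>?S. lscale (Poly_Mapping.lookup p k) (g k)) + (\<Sum>k\<in>?S. lscale (Poly_Mapping.lookup q k) (g k))"
    by (simp add: lookup_add lscale_add_left sum.distrib)
  also have "\<dots> = lin g p + lin g q"
    by (simp add: lin_superset[of ?S p] lin_superset[of ?S q])
  finally show ?thesis .
qed

lemma lin_lscale: "lin g (lscale r p) = lscale r (lin g p)"
proof -
  have "lin g (lscale r p) = (\<Sum>k\<in>Poly_Mapping.keys p. lscale (Poly_Mapping.lookup (lscale r p) k) (g k))"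
    by (rule lin_superset) (simp_all add: keys_lscale)
  then show ?thesis by (simp add: lin_def lscale_sum)
qed

lemma lin_uminus: "lin g (- p) = - lin g p"
  by (simp add: lin_def lscale_uminus sum_negf)

lemma lin_diff: "lin g (p - q) = lin g p - lin g q"
  using lin_add[of g p "- q"] by (simp add: lin_uminus)

lemma lin_sum: "lin g (\<Sum>i\<in>A. f i) = (\<Sum>i\<in>A. lin g (f i))"
  by (induction A rule: infinite_finite_induct) (simp_all add: lin_add)

lemma lin_zero_fun: "(\<And>k. k \<in> Poly_Mapping.keys p \<Longrightarrow> g k = 0) \<Longrightarrow> lin g p = 0"
  by (simp add: lin_def)

lemma lin_lin: "lin h (lin g p) = lin (\<lambda>k. lin h (g k)) p"
  by (simp add: lin_def[of g] lin_def[of "\<lambda>k. lin h (g k)"] lin_sum lin_lscale)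

lemma lin_single_one: "lin (\<lambda>k. Poly_Mapping.single k 1) p = p"
  using poly_mapping_expansion[of p] by (simp add: lin_def)

text \<open>The two sides multiply the coefficients of \<open>f\<close> and \<open>v\<close> in
  opposite orders, so the interchange of sums needs one of the two families to be central.\<close>

lemma lin_swap:
  assumes "central v"
  shows "lin (\<lambda>w. lin (h w) v) f = lin (\<lambda>k. lin (\<lambda>w. h w k) f) v"
proof -
  have "Poly_Mapping.lookup f w * Poly_Mapping.lookup v k = Poly_Mapping.lookup v k * Poly_Mapping.lookup f w" for w k
    using assms by (simp add: central_def)
  then show ?thesis
    unfolding lin_def by (simp add: lscale_sum) (rule sum.swap)
qed

text \<open>On the left \<open>r\<close> stands between the coefficients of \<open>p\<close> and
  those of \<open>g k\<close>; centrality of \<open>g k\<close> moves it to the right end.\<close>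

lemma lin_rscale:
  assumes "\<And>k. k \<in> Poly_Mapping.keys p \<Longrightarrow> central (g k)"
  shows "lin g (rscale p r) = rscale (lin g p) r"
proof -
  have "lin g (rscale p r) = (\<Sum>k\<in>Poly_Mapping.keys p. lscale (Poly_Mapping.lookup (rscale p r) k) (g k))"
    by (rule lin_superset) (simp_all add: keys_rscale)
  also have "\<dots> = rscale (lin g p) r"
  proof (rule poly_mapping_eqI)
    fix j
    have "Poly_Mapping.lookup p k * r * Poly_Mapping.lookup (g k) j
        = Poly_Mapping.lookup p k * Poly_Mapping.lookup (g k) j * r"
      if "k \<in> Poly_Mapping.keys p" for k
      using assms[OF that] by (metis central_def mult.assoc)
    then show "Poly_Mapping.lookup (\<Sum>k\<in>Poly_Mapping.keys p.
        lscale (Poly_Mapping.lookup (rscale p r) k) (g k)) j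
      = Poly_Mapping.lookup (rscale (lin g p) r) j"
      by (simp add: lin_def lookup_sum sum_distrib_right cong: sum.cong)
  qed
  finally show ?thesis .
qed

text \<open>In a product \<open>f * a\<close> the coefficients of \<open>a\<close> stand directly to
  the right of those of \<open>f\<close>. Collecting by the words of \<open>a\<close> therefore
  leaves right multiples of \<open>f\<close>, with no commutation of scalars.\<close>

lemma lin_lin_rscale:
  "lin (\<lambda>u. lin (\<lambda>w. h w u) a) f
    = (\<Sum>w\<in>Poly_Mapping.keys a. lin (h w) (rscale f (Poly_Mapping.lookup a w)))"
proof -
  have "lin (h w) (rscale f c)
      = (\<Sum>u\<in>Poly_Mapping.keys f. lscale (Poly_Mapping.lookup f u * c) (h w u))" for w c
    using lin_superset[OF finite_keys keys_rscale, of "h w" f c] by simp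
  then show ?thesis
    by (simp add: lin_def[of _ f] lin_def[of _ a] lscale_sum) (rule sum.swap)
qed

lemma central_zero [simp]: "central 0"
  and central_single [simp]: "central (Poly_Mapping.single k 1)"
  and central_add: "central p \<Longrightarrow> central q \<Longrightarrow> central (p + q)"
  and central_diff: "central p \<Longrightarrow> central q \<Longrightarrow> central (p - q)"
  by (auto simp: central_def lookup_single when_def lookup_add lookup_minus algebra_simps)

lemma central_sum: "(\<And>i. i \<in> A \<Longrightarrow> central (f i)) \<Longrightarrow> central (\<Sum>i\<in>A. f i)"
  by (induction A rule: infinite_finite_induct) (auto intro: central_add)

lemma central_lin:
  assumes "central p" "\<And>k. k \<in> Poly_Mapping.keys p \<Longrightarrow> central (g k)"
  shows "central (lin g p)"
  unfolding lin_def
proof (rule central_sum)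
  fix k assume "k \<in> Poly_Mapping.keys p"
  then show "central (lscale (Poly_Mapping.lookup p k) (g k))"
    using assms unfolding central_def lookup_lscale by (metis mult.assoc)
qed

section \<open>Linear extensions and products of words\<close>

lemma lin_single_mult:
  "lin g (Poly_Mapping.single u c * f) = lscale c (lin (\<lambda>w. g (u @ w)) f)"
proof -
  have "Poly_Mapping.single u c * f
      = (\<Sum>w\<in>Poly_Mapping.keys f. Poly_Mapping.single (u @ w) (c * Poly_Mapping.lookup f w))"
    by (subst poly_mapping_expansion[of f])
      (simp add: sum_distrib_left mult_single plus_list_def)
  then show ?thesis by (simp add: lin_sum lin_def[of _ f] lscale_sum)
qed

lemma lin_mult_left:
  "lin g (a * f) = lin (\<lambda>u. lin (\<lambda>w. g (u @ w)) f) a"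
proof -
  have "a * f = (\<Sum>u\<in>Poly_Mapping.keys a. Poly_Mapping.single u (Poly_Mapping.lookup a u) * f)"
    by (subst poly_mapping_expansion[of a]) (simp add: sum_distrib_right)
  then show ?thesis by (simp add: lin_sum lin_single_mult lin_def[of _ a])
qed

lemma lin_word [simp]: "lin g (word w) = g w"
  by (simp add: word_def)

lemma word_mult_word: "word u * word w = word (u @ w)"
  by (simp add: word_def mult_single plus_list_def)

lemma word_Nil_mult [simp]: "word [] * f = f"
proof -
  have "word [] * f = lscale 1 f"
    unfolding lscale_def mult_map_scale_conv_mult by (simp add: word_def zero_list_def)
  then show ?thesis by simp
qed

lemma lscale_mult: "lscale r f * g = lscale r (f * g)"
  for f g :: "'x list \<Rightarrow>\<^sub>0 'r::{ring,monoid_mult}"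
  by (simp add: lscale_def mult_map_scale_conv_mult mult.assoc)

lemma lin_mult_const: "lin g v * f = lin (\<lambda>k. g k * f) v"
  for f :: "'x list \<Rightarrow>\<^sub>0 'r::{ring,monoid_mult}"
  by (simp add: lin_def sum_distrib_right lscale_mult)

lemma rscale_zero [simp]: "rscale 0 r = 0"
  by (rule poly_mapping_eqI) simp

section \<open>Ideals and quotients of the free ring\<close>

lemma free_bimodule_ring_simps:
  "carrier (free_bimodule_ring X) = {f. Poly_Mapping.keys f \<subseteq> {w. w \<noteq> [] \<and> set w \<subseteq> X}}"
  "monoid.mult (free_bimodule_ring X) = (*)"
  "zero (free_bimodule_ring X) = 0"
  "add (free_bimodule_ring X) = (+)"
  "smult (free_bimodule_ring X) = lscale"
  "rsmult (free_bimodule_ring X) = rscale"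
  by (simp_all add: free_bimodule_ring_def lscale_def rscale_def fun_eq_iff)

lemma free_carrierI:
  "(\<And>w. w \<in> Poly_Mapping.keys f \<Longrightarrow> w \<noteq> [] \<and> set w \<subseteq> X) \<Longrightarrow> f \<in> carrier (free_bimodule_ring X)"
  by (auto simp: free_bimodule_ring_simps)

lemma free_carrierD:
  "f \<in> carrier (free_bimodule_ring X) \<Longrightarrow> w \<in> Poly_Mapping.keys f \<Longrightarrow> w \<noteq> [] \<and> set w \<subseteq> X"
  by (auto simp: free_bimodule_ring_simps)

lemma free_carrier_zero [simp]: "0 \<in> carrier (free_bimodule_ring X)"
  and free_carrier_word [simp]: "w \<noteq> [] \<Longrightarrow> set w \<subseteq> X \<Longrightarrow> word w \<in> carrier (free_bimodule_ring X)"
  by (auto intro!: free_carrierI simp: word_def split: if_splits)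

lemma free_carrier_diff [intro]:
  assumes "f \<in> carrier (free_bimodule_ring X)" "g \<in> carrier (free_bimodule_ring X)"
  shows "f - g \<in> carrier (free_bimodule_ring X)"
  using assms keys_diff_subset[of f g] by (auto simp: free_bimodule_ring_simps)

lemma free_carrier_add [intro]:
  assumes "f \<in> carrier (free_bimodule_ring X)" "g \<in> carrier (free_bimodule_ring X)"
  shows "f + g \<in> carrier (free_bimodule_ring X)"
  using assms Poly_Mapping.keys_add[of f g] by (auto simp: free_bimodule_ring_simps)

lemma free_carrier_lscale [intro]:
  "f \<in> carrier (free_bimodule_ring X) \<Longrightarrow> lscale r f \<in> carrier (free_bimodule_ring X)"
  using keys_lscale[of r f] by (auto simp: free_bimodule_ring_simps)

lemma free_carrier_rscale [intro]:
  "f \<in> carrier (free_bimodule_ring X) \<Longrightarrow> rscale f r \<in> carrier (free_bimodule_ring X)"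
  using keys_rscale[of f r] by (auto simp: free_bimodule_ring_simps)

lemma free_carrier_sum:
  "(\<And>i. i \<in> A \<Longrightarrow> f i \<in> carrier (free_bimodule_ring X)) \<Longrightarrow>
    (\<Sum>i\<in>A. f i) \<in> carrier (free_bimodule_ring X)"
  by (induction A rule: infinite_finite_induct) auto

lemma free_carrier_mult [intro]:
  assumes "f \<in> carrier (free_bimodule_ring X)" "g \<in> carrier (free_bimodule_ring X)"
  shows "f * g \<in> carrier (free_bimodule_ring X)"
proof (rule free_carrierI)
  fix w assume "w \<in> Poly_Mapping.keys (f * g)"
  then obtain a b where "w = a + b" "a \<in> Poly_Mapping.keys f" "b \<in> Poly_Mapping.keys g"
    using keys_mult[of f g] by blast
  then show "w \<noteq> [] \<and> set w \<subseteq> X"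
    using assms free_carrierD by (fastforce simp: plus_list_def)
qed

lemma abelian_group_free: "abelian_group (free_bimodule_ring X)"
proof (rule abelian_groupI)
  fix f assume f: "f \<in> carrier (free_bimodule_ring X)"
  show "\<exists>g\<in>carrier (free_bimodule_ring X). g \<oplus>\<^bsub>free_bimodule_ring X\<^esub> f = \<zero>\<^bsub>free_bimodule_ring X\<^esub>"
    using free_carrier_diff[OF free_carrier_zero f]
    by (intro bexI[of _ "- f"]) (simp_all add: free_bimodule_ring_simps(3,4))
qed (auto simp: free_bimodule_ring_simps(3,4) algebra_simps)

lemma a_inv_free:
  assumes "f \<in> carrier (free_bimodule_ring X)"
  shows "\<ominus>\<^bsub>free_bimodule_ring X\<^esub> f = - f"
  using assms free_carrier_diff[OF free_carrier_zero assms]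
  by (intro abelian_group.minus_equality[OF abelian_group_free])
    (auto simp: free_bimodule_ring_simps(3,4))

lemma additive_subgroup_free_iff:
  "additive_subgroup I (free_bimodule_ring X) \<longleftrightarrow>
     I \<subseteq> carrier (free_bimodule_ring X) \<and> 0 \<in> I \<and> (\<forall>f\<in>I. \<forall>g\<in>I. f - g \<in> I)"
    (is "?L \<longleftrightarrow> ?R")
proof
  assume ?L
  then interpret additive_subgroup I "free_bimodule_ring X" .
  have sub: "I \<subseteq> carrier (free_bimodule_ring X)" by (rule a_subset)
  have "0 \<in> I" using zero_closed by (simp add: free_bimodule_ring_simps)
  moreover have "f - g \<in> I" if "f \<in> I" "g \<in> I" for f g
    using a_closed[OF that(1) a_inv_closed[OF that(2)]] sub that(2)
    by (simp add: a_inv_free subset_iff free_bimodule_ring_simps(4))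
  ultimately show ?R using sub by blast
next
  assume R: ?R
  then have neg: "- g \<in> I" if "g \<in> I" for g
    using that by (metis diff_0)
  have add: "f + g \<in> I" if "f \<in> I" "g \<in> I" for f g
    using R neg[OF that(2)] that(1) by (metis diff_minus_eq_add)
  have inv: "inv\<^bsub>add_monoid (free_bimodule_ring X)\<^esub> f = - f" if "f \<in> I" for f
    using that R a_inv_free[of f X] by (auto simp only: a_inv_def)
  show ?L
  proof (intro additive_subgroup.intro subgroup.intro)
    show "inv\<^bsub>add_monoid (free_bimodule_ring X)\<^esub> f \<in> I" if "f \<in> I" for f
      using that inv neg by (simp only:)
  qed (use R add in \<open>auto simp: free_bimodule_ring_simps(3,4)\<close>)
qed

lemma bimodule_ideal_free_iff:
  "bimodule_ideal (free_bimodule_ring X) I \<longleftrightarrow>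
     I \<subseteq> carrier (free_bimodule_ring X) \<and> 0 \<in> I \<and> (\<forall>f\<in>I. \<forall>g\<in>I. f - g \<in> I) \<and>
     (\<forall>f\<in>I. \<forall>r. lscale r f \<in> I \<and> rscale f r \<in> I) \<and>
     (\<forall>f\<in>I. \<forall>a\<in>carrier (free_bimodule_ring X). a * f \<in> I \<and> f * a \<in> I)"
  unfolding bimodule_ideal_def additive_subgroup_free_iff
  by (simp add: free_bimodule_ring_simps(2,5,6) conj_assoc)

lemma bimodule_ideal_carrier: "bimodule_ideal (free_bimodule_ring X) (carrier (free_bimodule_ring X))"
  by (auto simp: bimodule_ideal_free_iff)

text \<open>The closure conditions pass to intersections. Containment in the carrier holds because
  the carrier is itself one of the ideals intersected, which is where the assumption on
  \<open>S\<close> enters.\<close>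

lemma bimodule_ideal_hull:
  assumes "S \<subseteq> carrier (free_bimodule_ring X)"
  shows "bimodule_ideal (free_bimodule_ring X) (bimodule_ideal (free_bimodule_ring X) hull S)"
proof -
  have "bimodule_ideal (free_bimodule_ring X) hull S \<subseteq> carrier (free_bimodule_ring X)"
    by (intro hull_minimal assms bimodule_ideal_carrier)
  then show ?thesis
    unfolding bimodule_ideal_free_iff[of X "_ hull _"]
    by (auto simp: hull_def bimodule_ideal_free_iff)
qed

lemma a_r_coset_free:
  "I +>\<^bsub>free_bimodule_ring X\<^esub> f = (\<lambda>h. h + f) ` I"
  by (auto simp: a_r_coset_def' free_bimodule_ring_simps(4))

section \<open>Cosets and congruence modulo an ideal of the free ring\<close>

locale free_quotient =
  fixes X :: "'x set" and I :: "('x list \<Rightarrow>\<^sub>0 'r::{ring,monoid_mult}) set"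
  assumes ideal: "bimodule_ideal (free_bimodule_ring X) I"
begin

abbreviation A where "A \<equiv> free_bimodule_ring X :: ('r, 'x list \<Rightarrow>\<^sub>0 'r) bimodule_ring"

abbreviation coset :: "('x list \<Rightarrow>\<^sub>0 'r) \<Rightarrow> ('x list \<Rightarrow>\<^sub>0 'r) set" where
  "coset f \<equiv> I +>\<^bsub>A\<^esub> f"

lemma ideal_zero: "0 \<in> I"
    and ideal_diff: "f \<in> I \<Longrightarrow> g \<in> I \<Longrightarrow> f - g \<in> I"
    and ideal_lscale: "f \<in> I \<Longrightarrow> lscale r f \<in> I"
    and ideal_mult_left: "f \<in> I \<Longrightarrow> a \<in> carrier A \<Longrightarrow> a * f \<in> I"
    and ideal_mult_right: "f \<in> I \<Longrightarrow> a \<in> carrier A \<Longrightarrow> f * a \<in> I"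
  using ideal unfolding bimodule_ideal_free_iff by blast+

lemma ideal_uminus: "f \<in> I \<Longrightarrow> - f \<in> I"
  using ideal_diff[OF ideal_zero] by simp

lemma ideal_add: "f \<in> I \<Longrightarrow> g \<in> I \<Longrightarrow> f + g \<in> I"
  using ideal_diff[of f "- g"] ideal_uminus[of g] by simp

lemma coset_eq_iff: "coset f = coset g \<longleftrightarrow> f - g \<in> I"
proof
  assume "coset f = coset g"
  moreover have "f \<in> coset f"
    using ideal_zero by (force simp: a_r_coset_free)
  ultimately obtain h where "h \<in> I" "f = h + g"
    by (auto simp: a_r_coset_free)
  then show "f - g \<in> I" by simp
next
  assume d: "f - g \<in> I"
  have "h + f \<in> coset g" if "h \<in> I" for h
    unfolding a_r_coset_free using ideal_add[OF that d]
    by (intro image_eqI[of _ _ "h + (f - g)"]) simp_all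
  moreover have "h + g \<in> coset f" if "h \<in> I" for h
    unfolding a_r_coset_free using ideal_diff[OF that d]
    by (intro image_eqI[of _ _ "h - (f - g)"]) simp_all
  ultimately show "coset f = coset g"
    by (auto simp: a_r_coset_free)
qed

lemma coset_zero: "coset 0 = I"
  by (simp add: a_r_coset_free)

lemma coset_add: "coset f <+>\<^bsub>A\<^esub> coset g = coset (f + g)"
proof -
  have "h + f + (k + g) \<in> coset (f + g)" if "h \<in> I" "k \<in> I" for h k
    unfolding a_r_coset_free using ideal_add[OF that]
    by (intro image_eqI[of _ _ "h + k"]) (simp_all add: algebra_simps)
  moreover have "h + (f + g) \<in> coset f <+>\<^bsub>A\<^esub> coset g" if "h \<in> I" for h
  proof -
    have "h + (f + g) = (h + f) + (0 + g)" by (simp add: algebra_simps)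
    then show ?thesis
      unfolding set_add_def' a_r_coset_free free_bimodule_ring_simps(4)
      using that ideal_zero by blast
  qed
  ultimately show ?thesis
    unfolding set_add_def' a_r_coset_free free_bimodule_ring_simps(4) by auto
qed

abbreviation M where "M \<equiv> quotient_bimodule_ring A I"

lemma carrier_quotient: "carrier M = coset ` carrier A"
  by (auto simp: quotient_bimodule_ring_def A_RCOSETS_def' a_r_coset_def')

lemma add_quotient: "coset f \<oplus>\<^bsub>M\<^esub> coset g = coset (f + g)"
  using coset_add by (simp add: quotient_bimodule_ring_def)

lemma zero_quotient: "\<zero>\<^bsub>M\<^esub> = coset 0"
  by (simp add: quotient_bimodule_ring_def coset_zero)

text \<open>A scalar acts on a coset through a union over all representatives. This union is a
  single coset because \<open>I\<close> absorbs left scalars and a coset is not empty.\<close>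

lemma smult_quotient: "r \<odot>\<^bsub>M\<^esub> coset f = coset (lscale r f)"
proof -
  have "coset (lscale r x) = coset (lscale r f)" if "x \<in> coset f" for x
  proof -
    obtain h where "h \<in> I" "x = h + f"
      using \<open>x \<in> coset f\<close> by (auto simp: a_r_coset_free)
    then show ?thesis
      unfolding coset_eq_iff using ideal_lscale by (simp add: lscale_add)
  qed
  moreover have "coset f \<noteq> {}"
    using ideal_zero by (auto simp: a_r_coset_free)
  ultimately show ?thesis
    by (simp add: quotient_bimodule_ring_def free_bimodule_ring_simps(5))
qed

lemma abelian_monoid_quotient: "abelian_monoid M"
  by (rule abelian_monoidI)
    (auto simp: carrier_quotient add_quotient zero_quotient algebra_simps intro!: imageI)

lemma finsum_quotient:
  assumes "finite T" "\<And>i. i \<in> T \<Longrightarrow> f i \<in> carrier A"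
  shows "(\<Oplus>\<^bsub>M\<^esub>i\<in>T. coset (f i)) = coset (\<Sum>i\<in>T. f i)"
proof -
  interpret M: abelian_monoid M by (rule abelian_monoid_quotient)
  show ?thesis
    using assms
  proof (induction T)
    case empty
    then show ?case by (simp add: zero_quotient)
  next
    case (insert i T)
    then have "(\<Oplus>\<^bsub>M\<^esub>i\<in>insert i T. coset (f i)) = coset (f i) \<oplus>\<^bsub>M\<^esub> (\<Oplus>\<^bsub>M\<^esub>i\<in>T. coset (f i))"
      by (intro M.finsum_insert) (auto simp: carrier_quotient)
    then show ?case using insert by (simp add: add_quotient)
  qed
qed

text \<open>Calculating with representatives permits chains that mix equality and congruence; cosets
  return only in the final basis statement.\<close>

definition congr :: "('x list \<Rightarrow>\<^sub>0 'r) \<Rightarrow> ('x list \<Rightarrow>\<^sub>0 'r) \<Rightarrow> bool"  (infix "\<approx>" 50) where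
  "f \<approx> g \<longleftrightarrow> f - g \<in> I"

lemma congr_refl [simp]: "f \<approx> f"
  by (simp add: congr_def ideal_zero)

lemma congr_sym: "f \<approx> g \<Longrightarrow> g \<approx> f"
  using ideal_uminus[of "f - g"] by (simp add: congr_def)

lemma congr_trans [trans]: "f \<approx> g \<Longrightarrow> g \<approx> h \<Longrightarrow> f \<approx> h"
  using ideal_add[of "f - g" "g - h"] by (simp add: congr_def)

lemma congr_add: "f \<approx> g \<Longrightarrow> f' \<approx> g' \<Longrightarrow> f + f' \<approx> g + g'"
  using ideal_add[of "f - g" "f' - g'"] by (simp add: congr_def algebra_simps)

lemma congr_diff: "f \<approx> g \<Longrightarrow> f' \<approx> g' \<Longrightarrow> f - f' \<approx> g - g'"
  using ideal_diff[of "f - g" "f' - g'"] by (simp add: congr_def algebra_simps)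

lemma congr_sum: "(\<And>i. i \<in> T \<Longrightarrow> f i \<approx> g i) \<Longrightarrow> (\<Sum>i\<in>T. f i) \<approx> (\<Sum>i\<in>T. g i)"
  by (induction T rule: infinite_finite_induct) (auto intro: congr_add)

lemma congr_lscale: "f \<approx> g \<Longrightarrow> lscale r f \<approx> lscale r g"
  using ideal_lscale[of "f - g" r] by (simp add: congr_def lscale_diff)

lemma congr_lin:
  "(\<And>k. k \<in> Poly_Mapping.keys v \<Longrightarrow> f k \<approx> g k) \<Longrightarrow> lin f v \<approx> lin g v"
  unfolding lin_def by (intro congr_sum congr_lscale)

lemma congr_mult_right: "f \<approx> g \<Longrightarrow> a \<in> carrier A \<Longrightarrow> f * a \<approx> g * a"
  using ideal_mult_right[of "f - g" a] by (simp add: congr_def algebra_simps)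

lemma congr_word_mult: "f \<approx> g \<Longrightarrow> set p \<subseteq> X \<Longrightarrow> word p * f \<approx> word p * g"
  using ideal_mult_left[of "f - g" "word p"]
  \<comment> \<open>The free ring has no unit: \<open>word []\<close> lies outside its carrier, so
    absorption by the ideal does not cover the empty prefix, which multiplies as the identity
    instead.\<close>
  by (cases "p = []") (simp_all add: congr_def algebra_simps)

end

section \<open>The action on normal paths\<close>

text \<open>Links the subword conditions of \<open>normal_path\<close> to conditions on adjacent
  letters, the form in which \<open>normal_state\<close> checks them.\<close>

lemma sublist_pair_iff:
  "sublist [a, b] p \<longleftrightarrow> (\<exists>k. Suc k < length p \<and> p ! k = a \<and> p ! Suc k = b)"
proof -
  have "sublist [a, b] p \<longleftrightarrow> \<not> successively (\<lambda>x y. \<not> (x = a \<and> y = b)) p"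
  proof (induction p)
    case (Cons x p)
    then show ?case by (cases p) (auto simp: sublist_Cons_right)
  qed simp
  then show ?thesis by (auto simp: successively_conv_nth)
qed

lemma edge_mult_ghost:
  "edge \<omega> \<alpha> i * ghost \<omega> \<beta> j = (if i \<le> \<omega> \<alpha> \<and> j \<le> \<omega> \<beta> then word [Edge \<alpha> i, Ghost \<beta> j] else 0)"
  by (simp add: edge_def ghost_def word_def mult_single plus_list_def)

lemma ghost_mult_edge:
  "ghost \<omega> \<alpha> i * edge \<omega> \<beta> j = (if i \<le> \<omega> \<alpha> \<and> j \<le> \<omega> \<beta> then word [Ghost \<alpha> i, Edge \<beta> j] else 0)"
  by (simp add: edge_def ghost_def word_def mult_single plus_list_def)

text \<open>Beyond the smaller weight one of the two factors is 0 by the index convention, so the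
  maximum may be replaced by the minimum.\<close>

lemma sum_ghost_mult_edge:
  "(\<Sum>i = 1..max (\<omega> \<alpha>) (\<omega> \<beta>). ghost \<omega> \<alpha> i * edge \<omega> \<beta> i)
    = (\<Sum>i = 1..min (\<omega> \<alpha>) (\<omega> \<beta>). word [Ghost \<alpha> i, Edge \<beta> i])"
  by (intro sum.mono_neutral_cong_right) (auto simp: ghost_mult_edge)

fun is_vert :: "('v, 'e) letter \<Rightarrow> bool" where
  "is_vert (Vert v) = True"
| "is_vert _ = False"

section \<open>Forbidden pairs, contraction and the right action of letters\<close>

locale selected_weighted_graph = row_finite_weighted_graph E \<omega>
  for E :: "('v, 'e) pre_digraph" (structure) and \<omega> +
  fixes sel :: "'v \<Rightarrow> 'e"
  assumes sel: "v \<in> verts E \<Longrightarrow> \<not> sink E v \<Longrightarrow>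
    sel v \<in> arcs E \<and> tail E (sel v) = v \<and> \<omega> (sel v) = vertex_weight E \<omega> v"
begin

text \<open>Index ranges and membership in \<open>arcs E\<close> are left out, since the letters of
  a path supply them. The equation \<open>\<alpha> = sel (tail E \<alpha>)\<close> singles out the
  chosen edges without a quantifier over vertices.\<close>

fun forbidden :: "('v, 'e) letter \<Rightarrow> ('v, 'e) letter \<Rightarrow> bool" where
  "forbidden (Ghost \<alpha> i) (Edge \<beta> j) \<longleftrightarrow> i = 1 \<and> j = 1"
| "forbidden (Edge \<alpha> i) (Ghost \<beta> j) \<longleftrightarrow> \<alpha> = \<beta> \<and> \<alpha> = sel (tail E \<alpha>)"
| "forbidden _ _ \<longleftrightarrow> False"

text \<open>A pair \<open>(u, l)\<close> stands for the path from \<open>u\<close> spelled by \<open>rev l\<close>.\<close>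

fun path_end :: "'v \<times> ('v, 'e) letter list \<Rightarrow> 'v" where
  "path_end (u, []) = u"
| "path_end (u, y # q) = letter_range E y"

fun redex :: "('v, 'e) letter list \<Rightarrow> ('v, 'e) letter \<Rightarrow> bool" where
  "redex [] x \<longleftrightarrow> False"
| "redex (y # q) x \<longleftrightarrow> forbidden y x"

fun normal_state :: "'v \<times> ('v, 'e) letter list \<Rightarrow> bool" where
  "normal_state (u, []) \<longleftrightarrow> u \<in> verts E"
| "normal_state (u, x # l) \<longleftrightarrow> normal_state (u, l)
     \<and> x \<in> edge_letters E \<omega> \<union> ghost_letters E \<omega>
     \<and> path_end (u, l) = letter_source E x \<and> \<not> redex l x"

text \<open>The index set of the terms of relation (3) that survive the convention that letters with
  too large an index are 0.\<close>

definition out :: "'v \<Rightarrow> nat \<Rightarrow> nat \<Rightarrow> 'e set" where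
  "out v i j = {\<alpha> \<in> out_arcs E v. i \<le> \<omega> \<alpha> \<and> j \<le> \<omega> \<alpha>}"

abbreviation basis :: "'v \<times> ('v, 'e) letter list \<Rightarrow>
    ('v \<times> ('v, 'e) letter list) \<Rightarrow>\<^sub>0 'r::{ring,monoid_mult}" where
  "basis s \<equiv> Poly_Mapping.single s 1"

text \<open>Relations (4) and (3), each solved for its forbidden word, with letters reversed as in
  the states. The sum in the first clause starts at 2 because index 1 is the forbidden word
  itself.\<close>

fun contract :: "('v, 'e) letter \<Rightarrow> ('v, 'e) letter \<Rightarrow> 'v \<Rightarrow> ('v, 'e) letter list \<Rightarrow>
    ('v \<times> ('v, 'e) letter list) \<Rightarrow>\<^sub>0 'r::{ring,monoid_mult}" where
  "contract (Ghost \<alpha> i) (Edge \<beta> j) u q = (if \<alpha> = \<beta> then basis (u, q) else 0)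
     - (\<Sum>k = 2..min (\<omega> \<alpha>) (\<omega> \<beta>). basis (u, Edge \<beta> k # Ghost \<alpha> k # q))"
| "contract (Edge \<alpha> i) (Ghost \<beta> j) u q = (if i = j then basis (u, q) else 0)
     - (\<Sum>\<gamma> \<in> out (tail E \<alpha>) i j - {\<alpha>}. basis (u, Ghost \<gamma> j # Edge \<gamma> i # q))"
| "contract _ _ u q = 0"

text \<open>The formula for right multiplication by \<open>x\<close> on a normal path. The value 0
  reflects relations (1) and (2): a letter absorbs its source vertex, and distinct vertices have
  product 0.\<close>

fun append_letter :: "('v, 'e) letter \<Rightarrow> 'v \<times> ('v, 'e) letter list \<Rightarrow>
    ('v \<times> ('v, 'e) letter list) \<Rightarrow>\<^sub>0 'r::{ring,monoid_mult}" where
  "append_letter x (u, l) =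
     (if path_end (u, l) \<noteq> letter_source E x then 0
      else if is_vert x then basis (u, l)
      else if redex l x then contract (hd l) x u (tl l)
      else basis (u, x # l))"

definition act :: "('v, 'e) letter list \<Rightarrow>
    (('v \<times> ('v, 'e) letter list) \<Rightarrow>\<^sub>0 'r::{ring,monoid_mult}) \<Rightarrow>
    (('v \<times> ('v, 'e) letter list) \<Rightarrow>\<^sub>0 'r)" where
  "act w v = fold (\<lambda>x. lin (append_letter x)) w v"

lemma act_Nil [simp]: "act [] v = v"
  and act_Cons [simp]: "act (x # w) v = act w (lin (append_letter x) v)"
  and act_append: "act (w @ w') v = act w' (act w v)"
  by (simp_all add: act_def)

lemma act_lin: "act w (lin g v) = lin (\<lambda>k. act w (g k)) v"
  by (induction w arbitrary: g) (simp_all add: lin_lin)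

lemma act_eq_lin: "act w v = lin (\<lambda>k. act w (basis k)) v"
  using act_lin[of w basis v] by (simp add: lin_single_one)

lemma act_zero [simp]: "act w 0 = 0"
  by (subst act_eq_lin) simp

lemma finite_out [simp]: "v \<in> verts E \<Longrightarrow> finite (out v i j)"
  by (rule finite_subset[OF _ row_finite]) (auto simp: out_def)

lemma outD:
  assumes "\<alpha> \<in> out v i j"
  shows "\<alpha> \<in> arcs E" "tail E \<alpha> = v" "i \<le> \<omega> \<alpha>" "j \<le> \<omega> \<alpha>"
  using assms by (auto simp: out_def)

lemma tail_not_sink: "\<alpha> \<in> arcs E \<Longrightarrow> \<not> sink E (tail E \<alpha>)"
  by (auto simp: sink_def)

lemma weight_le_vertex_weight:
  assumes "\<alpha> \<in> arcs E"
  shows "\<omega> \<alpha> \<le> vertex_weight E \<omega> (tail E \<alpha>)"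
  unfolding vertex_weight_def using assms row_finite[of "tail E \<alpha>"] by (intro Max_ge) auto

lemma sel_out:
  assumes "v \<in> verts E" "\<not> sink E v" "i \<le> vertex_weight E \<omega> v" "j \<le> vertex_weight E \<omega> v"
  shows "sel v \<in> out v i j"
  using sel[OF assms(1,2)] assms(3,4) by (simp add: out_def)

lemma normal_state_path_end: "normal_state s \<Longrightarrow> path_end s \<in> verts E"
  by (cases s rule: path_end.cases) (auto simp: edge_letters_def ghost_letters_def)

lemma normal_state_start: "normal_state (u, l) \<Longrightarrow> u \<in> verts E"
  by (induction l) auto

lemma edge_ghost_letters_iff [simp]:
  "Edge \<alpha> i \<in> edge_letters E \<omega> \<longleftrightarrow> \<alpha> \<in> arcs E \<and> 1 \<le> i \<and> i \<le> \<omega> \<alpha>"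
  "Ghost \<alpha> i \<in> ghost_letters E \<omega> \<longleftrightarrow> \<alpha> \<in> arcs E \<and> 1 \<le> i \<and> i \<le> \<omega> \<alpha>"
  "Edge \<alpha> i \<notin> ghost_letters E \<omega>"
  "Ghost \<alpha> i \<notin> edge_letters E \<omega>"
  "Vert v \<notin> edge_letters E \<omega>"
  "Vert v \<notin> ghost_letters E \<omega>"
  by (auto simp: edge_letters_def ghost_letters_def)

lemma letters_iff [simp]:
  "Vert v \<in> letters E \<omega> \<longleftrightarrow> v \<in> verts E"
  "Edge \<alpha> i \<in> letters E \<omega> \<longleftrightarrow> \<alpha> \<in> arcs E \<and> 1 \<le> i \<and> i \<le> \<omega> \<alpha>"
  "Ghost \<alpha> i \<in> letters E \<omega> \<longleftrightarrow> \<alpha> \<in> arcs E \<and> 1 \<le> i \<and> i \<le> \<omega> \<alpha>"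
  by (auto simp: letters_def)

section \<open>The action preserves normality\<close>

lemma redexE:
  assumes "redex l x"
  obtains \<alpha> \<beta> q where "l = Ghost \<alpha> 1 # q" "x = Edge \<beta> 1"
  | \<alpha> i j q where "l = Edge \<alpha> i # q" "x = Ghost \<alpha> j" "\<alpha> = sel (tail E \<alpha>)"
proof (cases l)
  case Nil
  then show ?thesis using assms by simp
next
  case (Cons y q)
  then show ?thesis using assms that by (cases y; cases x) auto
qed

text \<open>\<open>normal_span v\<close> also requires central coefficients, since \<^const>\<open>lin\<close> commutes with
  right scaling only on such values.\<close>

definition normal_span :: "(('v \<times> ('v, 'e) letter list) \<Rightarrow>\<^sub>0 'r::{ring,monoid_mult}) \<Rightarrow> bool" where
  "normal_span v \<longleftrightarrow> central v \<and> (\<forall>s\<in>Poly_Mapping.keys v. normal_state s)"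

lemma normal_span_zero [simp]: "normal_span 0"
  and normal_span_basis: "normal_state s \<Longrightarrow> normal_span (basis s)"
  by (simp_all add: normal_span_def split: if_splits)

lemma normal_span_diff: "normal_span v \<Longrightarrow> normal_span w \<Longrightarrow> normal_span (v - w)"
  unfolding normal_span_def using keys_diff_subset[of v w] by (auto intro: central_diff)

lemma normal_span_sum:
  "(\<And>i. i \<in> A \<Longrightarrow> normal_span (f i)) \<Longrightarrow> normal_span (\<Sum>i\<in>A. f i)"
  unfolding normal_span_def using keys_sum_subset[of f A] by (auto intro!: central_sum)

lemma normal_span_lin:
  assumes "normal_span v" "\<And>s. normal_state s \<Longrightarrow> normal_span (g s)"
  shows "normal_span (lin g v)"
proof -
  have "Poly_Mapping.keys (lin g v) \<subseteq> (\<Union>s\<in>Poly_Mapping.keys v. Poly_Mapping.keys (g s))"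
    unfolding lin_def by (rule order_trans[OF keys_sum_subset UN_mono]) (simp_all add: keys_lscale)
  then have "\<forall>k\<in>Poly_Mapping.keys (lin g v). normal_state k"
    using assms unfolding normal_span_def by blast
  moreover have "central (lin g v)"
    using assms by (intro central_lin) (simp_all add: normal_span_def)
  ultimately show ?thesis by (simp add: normal_span_def)
qed

text \<open>A forbidden pair ending in a ghost letter compares structured edges only. Hence the
  index change made by relation (4) creates no forbidden pair with the letter before.\<close>

lemma redex_Ghost_index: "redex l (Ghost \<alpha> i) \<longleftrightarrow> redex l (Ghost \<alpha> j)"
proof (cases l)
  case (Cons y q)
  then show ?thesis by (cases y) auto
qed simp

text \<open>A forbidden pair ending in an edge letter looks at indices only. Hence the change of
  edge made by relation (3) creates no forbidden pair with the letter before.\<close>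

lemma redex_Edge_edge: "redex l (Edge \<alpha> i) \<longleftrightarrow> redex l (Edge \<beta> i)"
proof (cases l)
  case (Cons y q)
  then show ?thesis by (cases y) auto
qed simp

text \<open>The new pair is allowed because \<open>k\<close> is at least 2, and its junction with
  \<open>q\<close> is as before by \<open>redex_Ghost_index\<close>.\<close>

lemma normal_state_ghost_edge:
  assumes "normal_state (u, Ghost \<alpha> 1 # q)" "\<beta> \<in> arcs E" "tail E \<beta> = tail E \<alpha>"
    and "2 \<le> k" "k \<le> \<omega> \<alpha>" "k \<le> \<omega> \<beta>"
  shows "normal_state (u, Edge \<beta> k # Ghost \<alpha> k # q)"
  using assms redex_Ghost_index[of q \<alpha> k 1] by simp

text \<open>The new pair is allowed because only one edge is chosen at each vertex and \<gamma> is
  another one; its junction with \<open>q\<close> is as before by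
  \<open>redex_Edge_edge\<close>.\<close>

lemma normal_state_edge_ghost:
  assumes "normal_state (u, Edge \<alpha> i # q)" "\<alpha> = sel (tail E \<alpha>)" "1 \<le> j"
    and \<gamma>: "\<gamma> \<in> out (tail E \<alpha>) i j" "\<gamma> \<noteq> \<alpha>"
  shows "normal_state (u, Ghost \<gamma> j # Edge \<gamma> i # q)"
proof -
  have "sel (tail E \<gamma>) \<noteq> \<gamma>"
    using assms(2) \<gamma>(2) outD(2)[OF \<gamma>(1)] by simp
  then show ?thesis
    using assms(1,3) outD[OF \<gamma>(1)] redex_Edge_edge[of q \<gamma> i \<alpha>] by simp
qed

lemma normal_span_append_letter:
  assumes "normal_state s" "x \<in> letters E \<omega>"
  shows "normal_span (append_letter x s)"
proof -
  obtain u l where s: "s = (u, l)" by (cases s)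
  consider "path_end (u, l) \<noteq> letter_source E x" | "path_end (u, l) = letter_source E x" "is_vert x"
    | "path_end (u, l) = letter_source E x" "\<not> is_vert x" "\<not> redex l x"
    | "path_end (u, l) = letter_source E x" "\<not> is_vert x" "redex l x" by blast
  then show ?thesis
  proof cases
    case 1
    then show ?thesis by (simp add: s)
  next
    case 2
    then show ?thesis using assms by (simp add: s normal_span_basis)
  next
    case 3
    have "x \<in> edge_letters E \<omega> \<union> ghost_letters E \<omega>"
      using assms(2) 3(2) by (cases x) auto
    then show ?thesis using assms 3 by (simp add: s normal_span_basis)
  next
    case 4
    from 4(3) show ?thesis
    proof (cases rule: redexE)
      case (1 \<alpha> \<beta> q)
      have norm: "normal_state (u, Ghost \<alpha> 1 # q)" and "\<beta> \<in> arcs E" "tail E \<beta> = tail E \<alpha>"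
        using assms 4(1) by (simp_all add: s 1)
      then have "normal_span (\<Sum>k = 2..min (\<omega> \<alpha>) (\<omega> \<beta>). basis (u, Edge \<beta> k # Ghost \<alpha> k # q))"
        by (intro normal_span_sum normal_span_basis normal_state_ghost_edge) auto
      moreover have "normal_span (basis (u, q))"
        using norm by (intro normal_span_basis) simp
      ultimately have "normal_span ((if \<alpha> = \<beta> then basis (u, q) else 0)
          - (\<Sum>k = 2..min (\<omega> \<alpha>) (\<omega> \<beta>). basis (u, Edge \<beta> k # Ghost \<alpha> k # q)))"
        by (intro normal_span_diff) auto
      then show ?thesis
        using 4 by (simp add: s 1)
    next
      case (2 \<alpha> i j q)
      have norm: "normal_state (u, Edge \<alpha> i # q)" and "1 \<le> j"
        using assms by (simp_all add: s 2(1,2))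
      then have "normal_span (\<Sum>\<gamma>\<in>out (tail E \<alpha>) i j - {\<alpha>}. basis (u, Ghost \<gamma> j # Edge \<gamma> i # q))"
        using 2(3) by (intro normal_span_sum normal_span_basis normal_state_edge_ghost) auto
      moreover have "normal_span (basis (u, q))"
        using norm by (intro normal_span_basis) simp
      ultimately have "normal_span ((if i = j then basis (u, q) else 0)
          - (\<Sum>\<gamma>\<in>out (tail E \<alpha>) i j - {\<alpha>}. basis (u, Ghost \<gamma> j # Edge \<gamma> i # q)))"
        by (intro normal_span_diff) auto
      then show ?thesis
        using 4 by (simp add: s 2(1,2))
    qed
  qed
qed

lemma normal_span_act:
  "normal_span v \<Longrightarrow> set w \<subseteq> letters E \<omega> \<Longrightarrow> normal_span (act w v)"
  by (induction w arbitrary: v)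
    (auto intro!: normal_span_lin normal_span_append_letter)

section \<open>Relations (3) and (4) hold for the action\<close>

lemma sum_edge_mult_ghost:
  assumes "v \<in> verts E"
  shows "(\<Sum>\<alpha>\<in>out_arcs E v. edge \<omega> \<alpha> i * ghost \<omega> \<alpha> j)
    = (\<Sum>\<alpha>\<in>out v i j. word [Edge \<alpha> i, Ghost \<alpha> j])"
  unfolding out_def sum.inter_filter[OF row_finite[OF assms]] by (simp add: edge_mult_ghost)

text \<open>Only the summand of \<open>sel v\<close> contracts. Its correction terms are exactly the
  words pushed by the other summands, with opposite sign, so all that remains is the vertex
  term.\<close>

lemma sum_edge_ghost_irreducible:
  assumes "v \<in> verts E" "\<not> sink E v" "path_end (u, l) = v"
    and "i \<le> vertex_weight E \<omega> v" "j \<le> vertex_weight E \<omega> v" "\<not> redex l (Edge (sel v) i)"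
  shows "(\<Sum>\<alpha>\<in>out v i j. lin (append_letter (Ghost \<alpha> j)) (append_letter (Edge \<alpha> i) (u, l)))
    = (if i = j then basis (u, l) else (0 :: _ \<Rightarrow>\<^sub>0 'r::{ring,monoid_mult}))"
proof -
  let ?f = "\<lambda>\<alpha>. lin (append_letter (Ghost \<alpha> j)) (append_letter (Edge \<alpha> i) (u, l)) :: _ \<Rightarrow>\<^sub>0 'r"
  have sel_mem: "sel v \<in> out v i j"
    using assms by (intro sel_out)
  have irr: "\<not> redex l (Edge \<alpha> i)" for \<alpha>
    using assms(6) redex_Edge_edge by blast
  have other: "?f \<alpha> = basis (u, Ghost \<alpha> j # Edge \<alpha> i # l)"
    if "\<alpha> \<in> out v i j - {sel v}" for \<alpha>
    using that outD[of \<alpha> v i j] assms(3) irr by auto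
  have "?f (sel v) = (if i = j then basis (u, l) else 0)
      - (\<Sum>\<gamma>\<in>out v i j - {sel v}. basis (u, Ghost \<gamma> j # Edge \<gamma> i # l))"
    using outD[OF sel_mem] assms(3) irr by simp
  then show ?thesis
    using other assms(1) by (simp add: sum.remove[OF _ sel_mem] del: append_letter.simps)
qed

lemma sum_edge_ghost:
  assumes s: "normal_state s" and v: "v \<in> verts E" "\<not> sink E v"
    and ij: "1 \<le> i" "i \<le> vertex_weight E \<omega> v" "1 \<le> j" "j \<le> vertex_weight E \<omega> v"
  shows "(\<Sum>\<alpha>\<in>out v i j. lin (append_letter (Ghost \<alpha> j)) (append_letter (Edge \<alpha> i) s))
    = (if i = j \<and> path_end s = v then basis s else (0 :: _ \<Rightarrow>\<^sub>0 'r::{ring,monoid_mult}))"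
proof -
  obtain u l where ul: "s = (u, l)" by (cases s)
  consider "path_end s \<noteq> v" | "path_end s = v" "\<not> redex l (Edge (sel v) i)"
    | "path_end s = v" "redex l (Edge (sel v) i)" by blast
  then show ?thesis
  proof cases
    case 1
    then show ?thesis
      using outD(2)[of _ v i j] by (auto simp: ul intro!: sum.neutral)
  next
    case 2
    then show ?thesis
      using assms unfolding ul
      by (subst sum_edge_ghost_irreducible) (simp_all del: append_letter.simps)
  next
    case 3
    \<comment> \<open>The first overlap: the path ends in \<open>Ghost \<gamma> 1\<close>, so every
      summand contracts as soon as its edge letter is appended.\<close>
    from 3(2) obtain \<gamma> q where l: "l = Ghost \<gamma> 1 # q" and i: "i = 1"
      by (rule redexE) auto
    have \<gamma>: "\<gamma> \<in> arcs E" "tail E \<gamma> = v" "path_end (u, q) = head E \<gamma>" "\<not> redex q (Ghost \<gamma> 1)"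
      using s 3(1) by (simp_all add: ul l)
    have \<gamma>_weight: "\<omega> \<gamma> \<le> vertex_weight E \<omega> v"
      using weight_le_vertex_weight[OF \<gamma>(1)] \<gamma>(2) by simp
    let ?w = "\<lambda>\<alpha> k. lin (append_letter (Ghost \<alpha> j)) (append_letter (Edge \<alpha> k) (u, Ghost \<gamma> k # q)) :: _ \<Rightarrow>\<^sub>0 'r"
    have step: "lin (append_letter (Ghost \<alpha> j)) (append_letter (Edge \<alpha> i) s)
        = (if \<gamma> = \<alpha> then append_letter (Ghost \<alpha> j) (u, q) else 0)
          - (\<Sum>k = 2..min (\<omega> \<gamma>) (\<omega> \<alpha>). ?w \<alpha> k)" if "\<alpha> \<in> out v 1 j" for \<alpha>
    proof -
      have "append_letter (Edge \<alpha> i) s = (if \<gamma> = \<alpha> then basis (u, q) else (0 :: _ \<Rightarrow>\<^sub>0 'r))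
          - (\<Sum>k = 2..min (\<omega> \<gamma>) (\<omega> \<alpha>). append_letter (Edge \<alpha> k) (u, Ghost \<gamma> k # q))"
        using outD[OF that] \<gamma> by (simp add: ul l i)
      then show ?thesis
        by (simp add: lin_diff lin_sum del: append_letter.simps)
    qed
    \<comment> \<open>For fixed \<open>k\<close>, at least 2, a path ending in
      \<open>Ghost \<gamma> k\<close> does not contract with an edge letter of index
      \<open>k\<close>. The inner sum over \<alpha> is then relation (3) for the indices
      \<open>k\<close> and \<open>j\<close> in its irreducible case.\<close>
    have "(\<Sum>\<alpha>\<in>out v 1 j. \<Sum>k = 2..min (\<omega> \<gamma>) (\<omega> \<alpha>). ?w \<alpha> k)
        = (\<Sum>k = 2..\<omega> \<gamma>. \<Sum>\<alpha>\<in>out v k j. ?w \<alpha> k)"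
      unfolding sum.Sigma[OF finite_out[OF v(1)] ballI[OF finite_atLeastAtMost]]
        sum.Sigma[OF finite_atLeastAtMost ballI[OF finite_out[OF v(1)]]]
      by (rule sum.reindex_bij_witness[of _ "\<lambda>(k, \<alpha>). (\<alpha>, k)" "\<lambda>(\<alpha>, k). (k, \<alpha>)"])
        (auto simp: out_def)
    also have "\<dots> = (\<Sum>k = 2..\<omega> \<gamma>. if k = j then basis (u, Ghost \<gamma> k # q) else 0)"
      using v \<gamma> \<gamma>_weight ij
      by (intro sum.cong refl sum_edge_ghost_irreducible) auto
    also have "\<dots> = (if 2 \<le> j \<and> j \<le> \<omega> \<gamma> then basis (u, Ghost \<gamma> j # q) else 0)"
      by simp
    finally have tail_sum: "(\<Sum>\<alpha>\<in>out v 1 j. \<Sum>k = 2..min (\<omega> \<gamma>) (\<omega> \<alpha>). ?w \<alpha> k)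
      = (if 2 \<le> j \<and> j \<le> \<omega> \<gamma> then basis (u, Ghost \<gamma> j # q) else 0)" .
    have "(\<Sum>\<alpha>\<in>out v 1 j. if \<gamma> = \<alpha> then append_letter (Ghost \<alpha> j) (u, q) else (0 :: _ \<Rightarrow>\<^sub>0 'r))
        = (if j \<le> \<omega> \<gamma> then basis (u, Ghost \<gamma> j # q) else 0)"
      using v(1) \<gamma> weight_pos[OF \<gamma>(1)] redex_Ghost_index[of q \<gamma> j 1]
      by (simp add: sum.delta) (simp add: out_def)
    then have "(\<Sum>\<alpha>\<in>out v 1 j. lin (append_letter (Ghost \<alpha> j)) (append_letter (Edge \<alpha> i) s))
      = (if j \<le> \<omega> \<gamma> then basis (u, Ghost \<gamma> j # q) else (0 :: _ \<Rightarrow>\<^sub>0 'r))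
        - (if 2 \<le> j \<and> j \<le> \<omega> \<gamma> then basis (u, Ghost \<gamma> j # q) else 0)"
      using tail_sum by (simp add: step[unfolded One_nat_def] sum_subtractf del: append_letter.simps)
    \<comment> \<open>The two terms cancel when \<open>j\<close> is at least 2; when
      \<open>j\<close> is 1 only the first survives, and it is \<open>s\<close>.\<close>
    also have "\<dots> = (if i = j \<and> path_end s = v then basis s else 0)"
      using ij(3) weight_pos[OF \<gamma>(1)] 3(1) by (auto simp: i ul l)
    finally show ?thesis by (simp add: i)
  qed
qed

text \<open>If the edges \<alpha> and \<beta> have the same source, only the summand of index 1
  contracts, and its correction terms cancel the words pushed by the larger indices. Otherwise no
  summand can be appended at all. Index 1 is present because weights are positive.\<close>

lemma sum_ghost_edge_irreducible:
  assumes "\<alpha> \<in> arcs E" "\<beta> \<in> arcs E" "path_end (u, l) = head E \<alpha>" "\<not> redex l (Ghost \<alpha> 1)"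
  shows "(\<Sum>i = 1..min (\<omega> \<alpha>) (\<omega> \<beta>). lin (append_letter (Edge \<beta> i)) (append_letter (Ghost \<alpha> i) (u, l)))
    = (if \<alpha> = \<beta> then basis (u, l) else (0 :: _ \<Rightarrow>\<^sub>0 'r::{ring,monoid_mult}))"
proof -
  have irr: "\<not> redex l (Ghost \<alpha> i)" for i
    using assms(4) redex_Ghost_index by blast
  then have push: "append_letter (Ghost \<alpha> i) (u, l) = basis (u, Ghost \<alpha> i # l)" for i
    using assms(3) by simp
  show ?thesis
  proof (cases "tail E \<alpha> = tail E \<beta>")
    case False
    then show ?thesis unfolding push by auto
  next
    case True
    have "1 \<le> min (\<omega> \<alpha>) (\<omega> \<beta>)"
      using assms(1,2) weight_pos by simp
    then have split: "(\<Sum>i = 1..min (\<omega> \<alpha>) (\<omega> \<beta>). g i) = g 1 + (\<Sum>i = 2..min (\<omega> \<alpha>) (\<omega> \<beta>). g i)"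
      for g :: "nat \<Rightarrow> _ \<Rightarrow>\<^sub>0 'r"
      using sum.atLeast_Suc_atMost[of 1 _ g] by (simp add: numeral_2_eq_2)
    show ?thesis
      unfolding push split using True by simp
  qed
qed

lemma sum_ghost_edge:
  assumes s: "normal_state s" and \<alpha>: "\<alpha> \<in> arcs E" and \<beta>: "\<beta> \<in> arcs E"
  shows "(\<Sum>i = 1..min (\<omega> \<alpha>) (\<omega> \<beta>). lin (append_letter (Edge \<beta> i)) (append_letter (Ghost \<alpha> i) s))
    = (if \<alpha> = \<beta> \<and> path_end s = head E \<alpha> then basis s else (0 :: _ \<Rightarrow>\<^sub>0 'r::{ring,monoid_mult}))"
proof -
  obtain u l where ul: "s = (u, l)" by (cases s)
  consider "path_end s \<noteq> head E \<alpha>" | "path_end s = head E \<alpha>" "\<not> redex l (Ghost \<alpha> 1)"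
    | "path_end s = head E \<alpha>" "redex l (Ghost \<alpha> 1)" by blast
  then show ?thesis
  proof cases
    case 1
    then show ?thesis by (auto simp: ul)
  next
    case 2
    then show ?thesis
      using assms unfolding ul
      by (subst sum_ghost_edge_irreducible) (simp_all del: append_letter.simps)
  next
    case 3
    let ?v = "tail E \<alpha>"
    \<comment> \<open>The second overlap: the path ends in a chosen edge \<alpha>, with which every
      \<open>Ghost \<alpha> i\<close> contracts.\<close>
    from 3(2) obtain k q where l: "l = Edge \<alpha> k # q" and \<alpha>_sel: "\<alpha> = sel ?v"
      by (rule redexE) auto
    have k: "1 \<le> k" "k \<le> \<omega> \<alpha>" "path_end (u, q) = ?v" and "\<not> redex q (Edge \<alpha> k)"
      using s by (simp_all add: ul l)
    then have irr: "\<not> redex q (Edge \<gamma> k)" for \<gamma>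
      using redex_Edge_edge by blast
    have v: "?v \<in> verts E" using \<alpha> by simp
    have weight: "\<omega> \<gamma> \<le> \<omega> \<alpha>" if "\<gamma> \<in> arcs E" "tail E \<gamma> = ?v" for \<gamma>
      using weight_le_vertex_weight[OF that(1)] sel[OF v tail_not_sink[OF \<alpha>]] that(2) \<alpha>_sel by simp
    let ?w = "\<lambda>\<gamma> i. lin (append_letter (Edge \<beta> i)) (append_letter (Ghost \<gamma> i) (u, Edge \<gamma> k # q)) :: _ \<Rightarrow>\<^sub>0 'r"
    have step: "lin (append_letter (Edge \<beta> i)) (append_letter (Ghost \<alpha> i) s)
        = (if k = i then append_letter (Edge \<beta> i) (u, q) else 0)
          - (\<Sum>\<gamma>\<in>out ?v k i - {\<alpha>}. ?w \<gamma> i)" for i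
    proof -
      \<comment> \<open>Reading each correction term as the result of appending
        \<open>Ghost \<gamma> i\<close> to a path ending in \<open>Edge \<gamma> k\<close> exhibits
        an instance of relation (4) for \<gamma> and \<beta>.\<close>
      have "append_letter (Ghost \<gamma> i) (u, Edge \<gamma> k # q)
          = (basis (u, Ghost \<gamma> i # Edge \<gamma> k # q) :: _ \<Rightarrow>\<^sub>0 'r)"
        if "\<gamma> \<in> out ?v k i - {\<alpha>}" for \<gamma>
        using that outD[of \<gamma> ?v k i] \<alpha>_sel by auto
      then have "(\<Sum>\<gamma>\<in>out ?v k i - {\<alpha>}. ?w \<gamma> i)
          = (\<Sum>\<gamma>\<in>out ?v k i - {\<alpha>}. append_letter (Edge \<beta> i) (u, Ghost \<gamma> i # Edge \<gamma> k # q))"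
        by (simp del: append_letter.simps)
      moreover have "append_letter (Ghost \<alpha> i) s = (if k = i then basis (u, q) else (0 :: _ \<Rightarrow>\<^sub>0 'r))
          - (\<Sum>\<gamma>\<in>out ?v k i - {\<alpha>}. basis (u, Ghost \<gamma> i # Edge \<gamma> k # q))"
        using 3(1) \<alpha>_sel by (simp add: ul l)
      ultimately show ?thesis
        by (simp add: lin_diff lin_sum del: append_letter.simps)
    qed
    \<comment> \<open>Maximality of the weight of \<alpha> is essential here: no \<gamma> is
      heavier, so for fixed \<gamma> the index \<open>i\<close> runs through the full range of
      relation (4). Since \<gamma> is not the chosen edge, that relation is in its irreducible
      case.\<close>
    have "(\<Sum>i = 1..min (\<omega> \<alpha>) (\<omega> \<beta>). \<Sum>\<gamma>\<in>out ?v k i - {\<alpha>}. ?w \<gamma> i)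
        = (\<Sum>\<gamma>\<in>out ?v k k - {\<alpha>}. \<Sum>i = 1..min (\<omega> \<gamma>) (\<omega> \<beta>). ?w \<gamma> i)"
      unfolding sum.Sigma[OF finite_atLeastAtMost ballI[OF finite_Diff[OF finite_out[OF v]]]]
        sum.Sigma[OF finite_Diff[OF finite_out[OF v]] ballI[OF finite_atLeastAtMost]]
      by (rule sum.reindex_bij_witness[of _ "\<lambda>(k, \<alpha>). (\<alpha>, k)" "\<lambda>(\<alpha>, k). (k, \<alpha>)"])
        (auto simp: out_def intro: order_trans[OF _ weight])
    also have "\<dots> = (\<Sum>\<gamma>\<in>out ?v k k - {\<alpha>}. if \<gamma> = \<beta> then basis (u, Edge \<gamma> k # q) else 0)"
      using \<beta> \<alpha>_sel
      by (intro sum.cong refl sum_ghost_edge_irreducible) (auto simp: out_def)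
    also have "\<dots> = (if \<beta> \<in> out ?v k k - {\<alpha>} then basis (u, Edge \<beta> k # q) else 0)"
      using v by (simp add: sum.delta)
    finally have tail_sum: "(\<Sum>i = 1..min (\<omega> \<alpha>) (\<omega> \<beta>). \<Sum>\<gamma>\<in>out ?v k i - {\<alpha>}. ?w \<gamma> i)
      = (if \<beta> \<in> out ?v k k - {\<alpha>} then basis (u, Edge \<beta> k # q) else 0)" .
    have "(\<Sum>i = 1..min (\<omega> \<alpha>) (\<omega> \<beta>). if k = i then append_letter (Edge \<beta> i) (u, q) else (0 :: _ \<Rightarrow>\<^sub>0 'r))
        = (if \<beta> \<in> out ?v k k then basis (u, Edge \<beta> k # q) else 0)"
      using k \<beta> irr[of \<beta>] by (auto simp: sum.delta out_def)
    then have "(\<Sum>i = 1..min (\<omega> \<alpha>) (\<omega> \<beta>). lin (append_letter (Edge \<beta> i)) (append_letter (Ghost \<alpha> i) s))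
      = (if \<beta> \<in> out ?v k k then basis (u, Edge \<beta> k # q) else (0 :: _ \<Rightarrow>\<^sub>0 'r))
        - (if \<beta> \<in> out ?v k k - {\<alpha>} then basis (u, Edge \<beta> k # q) else 0)"
      using tail_sum by (simp add: step sum_subtractf del: append_letter.simps sum.delta sum.delta')
    \<comment> \<open>The two conditions differ only when \<beta> is \<alpha>, and then the
      surviving term is \<open>s\<close>.\<close>
    also have "\<dots> = (if \<alpha> = \<beta> \<and> path_end s = head E \<alpha> then basis s else 0)"
      using 3(1) k(2) \<alpha> by (auto simp: ul l out_def)
    finally show ?thesis .
  qed
qed

section \<open>The annihilator of the normal states contains the ideal\<close>

lemma wlpa_relations_carrier:
  "wlpa_relations E \<omega> \<subseteq> carrier (free_bimodule_ring (letters E \<omega>))"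
proof
  fix f :: "('v, 'e) letter list \<Rightarrow>\<^sub>0 'r::{ring,monoid_mult}"
  assume "f \<in> wlpa_relations E \<omega>"
  then show "f \<in> carrier (free_bimodule_ring (letters E \<omega>))"
  proof cases
    case (edge_ghost v i j)
    then show ?thesis
      unfolding edge_ghost(1) sum_edge_mult_ghost[OF edge_ghost(2)]
      by (intro free_carrier_diff free_carrier_sum) (auto simp: out_def)
  next
    case (ghost_edge \<alpha> \<beta>)
    then show ?thesis
      unfolding ghost_edge(1) sum_ghost_mult_edge
      by (intro free_carrier_diff free_carrier_sum) auto
  qed (auto intro!: free_carrier_diff)
qed

lemma append_letter_Vert_source:
  "lin (append_letter x) (append_letter (Vert (letter_source E x)) s) = append_letter x s"
  by (cases s) simp

text \<open>All terms of a contraction end at the range of \<open>x\<close>. For the shortened path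
  \<open>(u, q)\<close> this relies on normality, which matches the end of \<open>q\<close> with the
  source of the letter removed.\<close>

lemma append_letter_Vert_range:
  assumes "normal_state s"
  shows "lin (append_letter (Vert (letter_range E x))) (append_letter x s) = append_letter x s"
proof -
  obtain u l where s: "s = (u, l)" by (cases s)
  consider "path_end (u, l) \<noteq> letter_source E x" | "path_end (u, l) = letter_source E x" "is_vert x"
    | "path_end (u, l) = letter_source E x" "\<not> is_vert x" "\<not> redex l x"
    | "path_end (u, l) = letter_source E x" "\<not> is_vert x" "redex l x" by blast
  then show ?thesis
  proof cases
    case 2
    then show ?thesis by (cases x) (simp_all add: s)
  next
    case 4
    from 4(3) show ?thesis
    proof (cases rule: redexE)
      case (1 \<alpha> \<beta> q)
      then show ?thesis using assms 4 by (simp add: s lin_diff lin_sum lin_uminus)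
    next
      case (2 \<alpha> i j q)
      have "tail E \<gamma> = tail E \<alpha>" if "\<gamma> \<in> out (tail E \<alpha>) i j" for \<gamma>
        using outD(2)[OF that] .
      then show ?thesis using assms 4 2 by (simp add: s lin_diff lin_sum lin_uminus)
    qed
  qed (simp_all add: s)
qed

text \<open>Testing on normal states is deliberate: on a list that is not a path, a contraction can
  leave a term with the wrong end vertex, and relation (2) fails there.\<close>

definition annihilator :: "(('v, 'e) letter list \<Rightarrow>\<^sub>0 'r::{ring,monoid_mult}) set" where
  "annihilator = {f \<in> carrier (free_bimodule_ring (letters E \<omega>)).
     \<forall>s. normal_state s \<longrightarrow> lin (\<lambda>w. act w (basis s)) f = 0}"

lemma annihilatorD:
  assumes "f \<in> annihilator"
  shows "f \<in> carrier (free_bimodule_ring (letters E \<omega>))"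
    and "normal_state s \<Longrightarrow> lin (\<lambda>w. act w (basis s)) f = 0"
  using assms unfolding annihilator_def by blast+

text \<open>The passage from basis vectors to combinations is where the coefficients of
  \<open>f\<close> and those of \<open>v\<close> must commute.\<close>

lemma annihilates_normal_span:
  assumes "f \<in> annihilator" "normal_span v"
  shows "lin (\<lambda>w. act w v) f = 0"
proof -
  have "lin (\<lambda>w. act w v) f = lin (\<lambda>w. lin (\<lambda>k. act w (basis k)) v) f"
    by (subst act_eq_lin) (rule refl)
  also have "\<dots> = lin (\<lambda>k. lin (\<lambda>w. act w (basis k)) f) v"
    using assms(2) by (intro lin_swap) (simp add: normal_span_def)
  also have "\<dots> = 0"
    using assms(2) by (intro lin_zero_fun[of v] annihilatorD(2)[OF assms(1)]) (simp add: normal_span_def)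
  finally show ?thesis .
qed

text \<open>In \<open>a * f\<close> the words of \<open>a\<close> act first and lead into the normal
  span, where \<open>f\<close> vanishes. In \<open>f * a\<close> the element \<open>f\<close> acts
  first, but followed by scalars from \<open>a\<close>, which reduces the claim to closure under
  right scaling.\<close>

lemma bimodule_ideal_annihilator:
  "bimodule_ideal (free_bimodule_ring (letters E \<omega>))
     (annihilator :: (('v, 'e) letter list \<Rightarrow>\<^sub>0 'r::{ring,monoid_mult}) set)"
  (is "bimodule_ideal ?A _")
  unfolding bimodule_ideal_free_iff
proof (intro conjI ballI allI)
  fix f assume f: "f \<in> (annihilator :: (('v, 'e) letter list \<Rightarrow>\<^sub>0 'r) set)"
  then have fA: "f \<in> carrier ?A" by (rule annihilatorD)
  have span: "normal_span (act w (basis s) :: _ \<Rightarrow>\<^sub>0 'r)"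
    if "normal_state s" "set w \<subseteq> letters E \<omega>" for s w
    using that by (intro normal_span_act normal_span_basis)
  have rscale: "lin (\<lambda>w. act w (basis s)) (rscale f r) = 0" if "normal_state s" for s r
  proof -
    have "lin (\<lambda>w. act w (basis s)) (rscale f r) = rscale (lin (\<lambda>w. act w (basis s)) f) r"
      using span[OF that] free_carrierD[OF fA] by (intro lin_rscale) (simp add: normal_span_def)
    then show ?thesis
      by (simp add: annihilatorD(2)[OF f that] rscale_zero)
  qed
  show "lscale r f \<in> annihilator" "rscale f r \<in> annihilator" for r
    using f fA rscale by (auto simp: annihilator_def lin_lscale)
  fix a assume a: "a \<in> carrier ?A"
  have "lin (\<lambda>w. act w (basis s)) (a * f) = 0" if "normal_state s" for s
  proof -
    have "lin (\<lambda>w. act w (basis s)) (a * f) = lin (\<lambda>u. lin (\<lambda>w. act w (act u (basis s))) f) a"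
      by (simp add: lin_mult_left act_append)
    also have "\<dots> = 0"
      using annihilates_normal_span[OF f span[OF that]] free_carrierD[OF a]
      by (intro lin_zero_fun[of a]) simp
    finally show ?thesis .
  qed
  then show "a * f \<in> annihilator"
    using a fA by (auto simp: annihilator_def)
  have "lin (\<lambda>w. act w (basis s)) (f * a) = 0" if "normal_state s" for s
  proof -
    have "lin (\<lambda>w. act w (basis s)) (f * a)
        = (\<Sum>w\<in>Poly_Mapping.keys a. act w
            (lin (\<lambda>u. act u (basis s)) (rscale f (Poly_Mapping.lookup a w))))"
      by (simp add: lin_mult_left act_append lin_lin_rscale act_lin)
    then show ?thesis using rscale[OF that] by simp
  qed
  then show "f * a \<in> annihilator"
    using a fA by (auto simp: annihilator_def)
qed (auto simp: annihilator_def lin_diff)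

lemma wlpa_relations_annihilator: "wlpa_relations E \<omega> \<subseteq> annihilator"
proof
  fix f :: "('v, 'e) letter list \<Rightarrow>\<^sub>0 'r::{ring,monoid_mult}"
  assume f: "f \<in> wlpa_relations E \<omega>"
  have "lin (\<lambda>w. act w (basis s)) f = 0" if s: "normal_state s" for s
    using f
  proof cases
    case (vert_vert v w)
    then show ?thesis by (cases s) (auto simp: lin_diff)
  next
    case (source_edge \<alpha> i)
    then show ?thesis
      using append_letter_Vert_source[of "Edge \<alpha> i" s] by (simp add: lin_diff del: append_letter.simps)
  next
    case (edge_range \<alpha> i)
    then show ?thesis
      using append_letter_Vert_range[OF s, of "Edge \<alpha> i"] by (simp add: lin_diff del: append_letter.simps)
  next
    case (range_ghost \<alpha> i)
    then show ?thesis
      using append_letter_Vert_source[of "Ghost \<alpha> i" s] by (simp add: lin_diff del: append_letter.simps)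
  next
    case (ghost_source \<alpha> i)
    then show ?thesis
      using append_letter_Vert_range[OF s, of "Ghost \<alpha> i"] by (simp add: lin_diff del: append_letter.simps)
  next
    case (edge_ghost v i j)
    have "append_letter (Vert v) s = (if path_end s = v then basis s else (0 :: _ \<Rightarrow>\<^sub>0 'r))"
      by (cases s) auto
    then show ?thesis
      unfolding edge_ghost(1) sum_edge_mult_ghost[OF edge_ghost(2)]
      using sum_edge_ghost[where 'r='r, OF s edge_ghost(2-7)]
      by (simp add: lin_diff lin_sum del: append_letter.simps)
  next
    case (ghost_edge \<alpha> \<beta>)
    have "append_letter (Vert (head E \<alpha>)) s = (if path_end s = head E \<alpha> then basis s else (0 :: _ \<Rightarrow>\<^sub>0 'r))"
      by (cases s) auto
    then show ?thesis
      unfolding ghost_edge(1) sum_ghost_mult_edge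
      using sum_ghost_edge[where 'r='r, OF s ghost_edge(2,3)]
      by (cases "\<alpha> = \<beta>") (simp_all add: lin_diff lin_sum del: append_letter.simps)
  qed
  then show "f \<in> annihilator"
    using f wlpa_relations_carrier by (auto simp: annihilator_def)
qed

lemma wlpa_ideal_annihilator: "wlpa_ideal E \<omega> \<subseteq> annihilator"
  unfolding wlpa_ideal_def
  by (intro hull_minimal wlpa_relations_annihilator bimodule_ideal_annihilator)

section \<open>Normal states and normal generalised paths\<close>

fun path_word :: "'v \<times> ('v, 'e) letter list \<Rightarrow> ('v, 'e) letter list" where
  "path_word (u, l) = (if l = [] then [Vert u] else rev l)"

lemma normal_state_iff:
  "normal_state (u, l) \<longleftrightarrow> u \<in> verts E \<and> set l \<subseteq> edge_letters E \<omega> \<union> ghost_letters E \<omega>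
     \<and> successively (\<lambda>x y. letter_range E y = letter_source E x \<and> \<not> forbidden y x) l
     \<and> (l \<noteq> [] \<longrightarrow> letter_source E (last l) = u)"
proof (induction l)
  case (Cons x l)
  then show ?case by (cases l) auto
qed auto

lemma normal_state_letters: "normal_state (u, l) \<Longrightarrow> set l \<subseteq> letters E \<omega>"
  unfolding normal_state_iff letters_def by blast

lemma letter_source_verts: "x \<in> letters E \<omega> \<Longrightarrow> letter_source E x \<in> verts E"
  by (cases x) auto

text \<open>The letters of \<open>p\<close> supply the index ranges and arcs that
  \<open>forbidden\<close> omits; conversely, \<open>sel v\<close> starts at \<open>v\<close>, so
  each listed pair is forbidden.\<close>

lemma normal_word_iff:
  assumes "set p \<subseteq> edge_letters E \<omega> \<union> ghost_letters E \<omega>"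
  shows "(\<forall>v\<in>verts E. \<not> sink E v \<longrightarrow>
        (\<forall>i\<in>{1..\<omega> (sel v)}. \<forall>j\<in>{1..\<omega> (sel v)}.
           \<not> sublist [Edge (sel v) i, Ghost (sel v) j] p)) \<and>
      (\<forall>\<alpha>\<in>arcs E. \<forall>\<beta>\<in>arcs E. \<not> sublist [Ghost \<alpha> 1, Edge \<beta> 1] p)
    \<longleftrightarrow> (\<forall>k. Suc k < length p \<longrightarrow> \<not> forbidden (p ! k) (p ! Suc k))" (is "?L \<longleftrightarrow> ?R")
proof
  assume L: ?L
  show ?R
  proof (intro allI impI notI)
    fix k assume k: "Suc k < length p" and "forbidden (p ! k) (p ! Suc k)"
    \<comment> \<open>A one-letter list turns the pair into a redex, so that \<open>redexE\<close>
      provides the two shapes.\<close>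
    then have "redex (p ! k # []) (p ! Suc k)" by simp
    moreover have mem: "p ! k \<in> edge_letters E \<omega> \<union> ghost_letters E \<omega>"
      "p ! Suc k \<in> edge_letters E \<omega> \<union> ghost_letters E \<omega>"
      using assms k by (meson Suc_lessD nth_mem subsetD)+
    ultimately show False
    proof (elim redexE)
      fix \<alpha> \<beta> q
      assume "[p ! k] = Ghost \<alpha> 1 # q" "p ! Suc k = Edge \<beta> 1"
      then show False
        using L mem k by (auto simp: sublist_pair_iff)
    next
      fix \<alpha> i j q
      assume *: "[p ! k] = Edge \<alpha> i # q" "p ! Suc k = Ghost \<alpha> j" "\<alpha> = sel (tail E \<alpha>)"
      then have "\<alpha> \<in> arcs E" "i \<in> {1..\<omega> \<alpha>}" "j \<in> {1..\<omega> \<alpha>}"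
        using mem by auto
      moreover have "sublist [Edge \<alpha> i, Ghost \<alpha> j] p"
        using * k by (auto simp: sublist_pair_iff)
      ultimately show False
        using L *(3) tail_not_sink[of \<alpha>] tail_in_verts[of \<alpha>] by metis
    qed
  qed
next
  assume R: ?R
  show ?L
  proof (intro conjI ballI impI)
    fix v i j assume "v \<in> verts E" "\<not> sink E v"
    then have "forbidden (Edge (sel v) i) (Ghost (sel v) j)"
      using sel[of v] by simp
    then show "\<not> sublist [Edge (sel v) i, Ghost (sel v) j] p"
      using R unfolding sublist_pair_iff by metis
  next
    fix \<alpha> \<beta>
    have "forbidden (Ghost \<alpha> 1) (Edge \<beta> 1)" by simp
    then show "\<not> sublist [Ghost \<alpha> 1, Edge \<beta> 1] p"
      using R unfolding sublist_pair_iff by metis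
  qed
qed

lemma normal_path_Vert: "normal_path E \<omega> sel [Vert v] \<longleftrightarrow> v \<in> verts E"
  by (auto simp: normal_path_def generalised_path_def sublist_pair_iff)

lemma normal_path_rev:
  assumes "l \<noteq> []" "set l \<subseteq> edge_letters E \<omega> \<union> ghost_letters E \<omega>"
  shows "normal_path E \<omega> sel (rev l) \<longleftrightarrow> normal_state (letter_source E (last l), l)"
proof -
  have "generalised_path E \<omega> (rev l)
      \<longleftrightarrow> (\<forall>k. Suc k < length (rev l) \<longrightarrow> letter_range E (rev l ! k) = letter_source E (rev l ! Suc k))"
    using assms by (auto simp: generalised_path_def)
  then have "normal_path E \<omega> sel (rev l)
      \<longleftrightarrow> successively (\<lambda>x y. letter_range E x = letter_source E y \<and> \<not> forbidden x y) (rev l)"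
    unfolding normal_path_def successively_conv_nth
    using normal_word_iff[of "rev l"] assms(2) by auto
  moreover have "letter_source E (last l) \<in> verts E"
    using assms(2) last_in_set[OF assms(1)]
    by (intro letter_source_verts) (unfold letters_def, blast)
  ultimately show ?thesis
    using assms by (simp add: normal_state_iff)
qed

lemma normal_path_path_word:
  assumes "normal_state s"
  shows "normal_path E \<omega> sel (path_word s)"
proof (cases s)
  case (Pair u l)
  show ?thesis
  proof (cases "l = []")
    case False
    then have "u = letter_source E (last l)" "set l \<subseteq> edge_letters E \<omega> \<union> ghost_letters E \<omega>"
      using assms unfolding Pair normal_state_iff by simp_all
    then show ?thesis
      using False assms normal_path_rev[of l] by (simp add: Pair)
  qed (use assms Pair normal_path_Vert in simp)
qed

lemma normal_pathE:
  assumes "normal_path E \<omega> sel p"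
  obtains s where "normal_state s" "p = path_word s"
proof (cases "\<exists>v\<in>verts E. p = [Vert v]")
  case True
  then obtain v where "v \<in> verts E" "p = [Vert v]" by blast
  then show ?thesis using that[of "(v, [])"] by simp
next
  case False
  then have p: "p \<noteq> []" "set p \<subseteq> edge_letters E \<omega> \<union> ghost_letters E \<omega>"
    using assms by (auto simp: normal_path_def generalised_path_def)
  then have "normal_state (letter_source E (last (rev p)), rev p)"
    using assms normal_path_rev[of "rev p"] by simp
  then show ?thesis using that p(1) by force
qed

lemma letter_source_hd_path_word: "normal_state s \<Longrightarrow> letter_source E (hd (path_word s)) = fst s"
  by (cases s) (auto simp: normal_state_iff hd_rev)

text \<open>The source of the first letter recovers the start vertex. The absence of vertex letters
  in the lists separates a trivial path from all others.\<close>

lemma path_word_inj: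
  assumes "normal_state s" "normal_state t" "path_word s = path_word t"
  shows "s = t"
proof -
  obtain u l v m where st: "s = (u, l)" "t = (v, m)"
    by (cases s; cases t)
  have "u = v"
    using letter_source_hd_path_word[OF assms(1)] letter_source_hd_path_word[OF assms(2)] assms(3)
    by (simp add: st)
  moreover have "Vert w \<notin> set l" "Vert w \<notin> set m" for w
    using assms(1,2) by (auto simp: st normal_state_iff)
  ultimately show ?thesis
    using assms(3) by (auto simp: st split: if_splits)
qed

lemma path_word_letters: "normal_state s \<Longrightarrow> path_word s \<noteq> [] \<and> set (path_word s) \<subseteq> letters E \<omega>"
  using normal_state_letters normal_state_start by (cases s) auto

text \<open>Reading a normal path never triggers a contraction, so its word rebuilds it letter by
  letter from its start vertex; from any other vertex the first letter gives 0.\<close>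

lemma act_path_word:
  assumes "normal_state (u, l)"
  shows "act (path_word (u, l)) (basis (v, [])) = (if v = u then basis (u, l) else (0 :: _ \<Rightarrow>\<^sub>0 'r::{ring,monoid_mult}))"
  using assms
proof (induction l)
  case (Cons x l)
  have x: "\<not> is_vert x" "path_end (u, l) = letter_source E x" "\<not> redex l x"
    using Cons.prems by (cases x; simp)+
  show ?case
  proof (cases "l = []")
    case True
    then show ?thesis using x by (simp add: act_def)
  next
    case False
    then have "act (path_word (u, x # l)) (basis (v, []) :: _ \<Rightarrow>\<^sub>0 'r)
        = lin (append_letter x) (act (path_word (u, l)) (basis (v, [])))"
      by (simp add: act_append)
    then show ?thesis
      using Cons x by simp
  qed
qed auto

end

section \<open>The basis\<close>

text \<open>The dummy parameter only fixes the coefficient type.\<close>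

locale weighted_leavitt = selected_weighted_graph E \<omega> sel
  for E :: "('v, 'e) pre_digraph" (structure) and \<omega> sel +
  fixes coefficients :: "'r::{ring,monoid_mult} itself"
begin

sublocale free_quotient "letters E \<omega>" "wlpa_ideal E \<omega> :: (('v, 'e) letter list \<Rightarrow>\<^sub>0 'r) set"
  by standard (simp add: wlpa_ideal_def bimodule_ideal_hull wlpa_relations_carrier)

notation congr (infix "\<approx>" 50)

section \<open>The defining relations as congruences\<close>

lemma relation_congr: "f - g \<in> wlpa_relations E \<omega> \<Longrightarrow> f \<approx> g"
  unfolding congr_def by (simp add: wlpa_ideal_def hull_inc)

lemma source_congr:
  assumes "x \<in> letters E \<omega>"
  shows "word [Vert (letter_source E x), x] \<approx> word [x]"
proof (cases x)
  case (Vert v)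
  then show ?thesis
    using assms relation_congr[OF wlpa_relations.vert_vert[of v _ v]] by simp
qed (use assms in \<open>auto intro!: relation_congr wlpa_relations.intros\<close>)

lemma range_congr:
  assumes "x \<in> letters E \<omega>"
  shows "word [x, Vert (letter_range E x)] \<approx> word [x]"
proof (cases x)
  case (Vert v)
  then show ?thesis
    using assms relation_congr[OF wlpa_relations.vert_vert[of v _ v]] by simp
qed (use assms in \<open>auto intro!: relation_congr wlpa_relations.intros\<close>)

lemma vert_vert_congr_zero:
  "v \<in> verts E \<Longrightarrow> w \<in> verts E \<Longrightarrow> v \<noteq> w \<Longrightarrow> word [Vert v, Vert w] \<approx> 0"
  using relation_congr[of "word [Vert v, Vert w]" 0] wlpa_relations.vert_vert[of v E w \<omega>] by simp

lemma path_word_mult_end: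
  assumes "normal_state s"
  shows "word (path_word s) * word [Vert (path_end s)] \<approx> word (path_word s)"
proof -
  obtain p x where px: "path_word s = p @ [x]"
    using path_word_letters[OF assms] by (metis rev_exhaust)
  moreover have "letter_range E x = path_end s"
    using px by (cases s rule: path_end.cases) auto
  moreover have "set p \<subseteq> letters E \<omega>" "x \<in> letters E \<omega>"
    using path_word_letters[OF assms] px by auto
  ultimately show ?thesis
    using congr_word_mult[OF range_congr[of x], of p]
    by (simp add: word_mult_word)
qed

text \<open>Relation (2) inserts the end vertex of the path and the source of \<open>x\<close>
  between the two factors; relation (1) makes the product of these distinct vertices 0.\<close>

lemma path_word_mult_mismatch:
  assumes s: "normal_state s" and x: "x \<in> letters E \<omega>" and ne: "path_end s \<noteq> letter_source E x"
  shows "word (path_word s) * word [x] \<approx> 0"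
proof -
  let ?p = "path_word s" and ?e = "Vert (path_end s)" and ?v = "Vert (letter_source E x)"
  have p: "set ?p \<subseteq> letters E \<omega>" "set (?p @ [?e]) \<subseteq> letters E \<omega>"
    using path_word_letters[OF s] normal_state_path_end[OF s] by auto
  have xA: "word [x] \<in> carrier A"
    using x by simp
  have "word ?p * word [x] \<approx> word (?p @ [?e]) * word [x]"
    using congr_mult_right[OF congr_sym[OF path_word_mult_end[OF s]] xA] by (simp add: word_mult_word)
  also have "\<dots> \<approx> word (?p @ [?e]) * word [?v, x]"
    by (rule congr_word_mult[OF congr_sym[OF source_congr[OF x]] p(2)])
  also have "\<dots> = word ?p * (word [?e, ?v] * word [x])"
    by (simp add: word_mult_word)
  also have "\<dots> \<approx> word ?p * (0 * word [x])"
    using ne normal_state_path_end[OF s] letter_source_verts[OF x]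
    by (intro congr_word_mult[OF congr_mult_right[OF vert_vert_congr_zero xA] p(1)])
  finally show ?thesis by simp
qed

text \<open>A relation is used only for the trivial path, where the vertex letter is absorbed by
  \<open>x\<close>; otherwise the two words coincide.\<close>

lemma path_word_mult_push:
  assumes "path_end (u, l) = letter_source E x" "x \<in> letters E \<omega>"
  shows "word (path_word (u, l)) * word [x] \<approx> word (path_word (u, x # l))"
  using assms source_congr[of x] by (cases "l = []") (simp_all add: word_mult_word)

lemma ghost_edge_congr:
  assumes "\<alpha> \<in> arcs E" "\<beta> \<in> arcs E"
  shows "word [Ghost \<alpha> 1, Edge \<beta> 1] \<approx> (if \<alpha> = \<beta> then word [Vert (head E \<alpha>)] else 0)
    - (\<Sum>k = 2..min (\<omega> \<alpha>) (\<omega> \<beta>). word [Ghost \<alpha> k, Edge \<beta> k])"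
proof -
  let ?f = "\<lambda>k. word [Ghost \<alpha> k, Edge \<beta> k] :: ('v, 'e) letter list \<Rightarrow>\<^sub>0 'r"
  have "1 \<le> min (\<omega> \<alpha>) (\<omega> \<beta>)"
    using assms weight_pos by simp
  then have "(\<Sum>k = 1..min (\<omega> \<alpha>) (\<omega> \<beta>). ?f k) = ?f 1 + (\<Sum>k = 2..min (\<omega> \<alpha>) (\<omega> \<beta>). ?f k)"
    using sum.atLeast_Suc_atMost[of 1 _ ?f] by (simp add: numeral_2_eq_2)
  moreover have "(\<Sum>k = 1..min (\<omega> \<alpha>) (\<omega> \<beta>). ?f k) \<approx> (if \<alpha> = \<beta> then word [Vert (head E \<alpha>)] else 0)"
    using relation_congr[OF wlpa_relations.ghost_edge[OF assms]] unfolding sum_ghost_mult_edge .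
  ultimately have "?f 1 + (\<Sum>k = 2..min (\<omega> \<alpha>) (\<omega> \<beta>). ?f k)
      \<approx> (if \<alpha> = \<beta> then word [Vert (head E \<alpha>)] else 0)" by simp
  from congr_diff[OF this congr_refl, of "\<Sum>k = 2..min (\<omega> \<alpha>) (\<omega> \<beta>). ?f k"]
  show ?thesis unfolding add_diff_cancel_right' .
qed

text \<open>Relation (3) is stated for indices up to the vertex weight. By the choice of
  \<open>sel\<close> this is the weight of \<alpha>, so the summand of \<alpha> is present and can
  be isolated.\<close>

lemma edge_ghost_congr:
  assumes "\<alpha> \<in> arcs E" "\<alpha> = sel (tail E \<alpha>)" "1 \<le> i" "i \<le> \<omega> \<alpha>" "1 \<le> j" "j \<le> \<omega> \<alpha>"
  shows "word [Edge \<alpha> i, Ghost \<alpha> j] \<approx> (if i = j then word [Vert (tail E \<alpha>)] else 0)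
    - (\<Sum>\<gamma>\<in>out (tail E \<alpha>) i j - {\<alpha>}. word [Edge \<gamma> i, Ghost \<gamma> j])"
proof -
  let ?f = "\<lambda>\<gamma>. word [Edge \<gamma> i, Ghost \<gamma> j] :: ('v, 'e) letter list \<Rightarrow>\<^sub>0 'r" and ?v = "tail E \<alpha>"
  have v: "?v \<in> verts E" "\<not> sink E ?v"
    using assms(1) tail_not_sink by auto
  have weight: "\<omega> \<alpha> = vertex_weight E \<omega> ?v"
    using sel[OF v] assms(2) by simp
  have "\<alpha> \<in> out ?v i j"
    using assms by (simp add: out_def)
  then have "(\<Sum>\<gamma>\<in>out ?v i j. ?f \<gamma>) = ?f \<alpha> + (\<Sum>\<gamma>\<in>out ?v i j - {\<alpha>}. ?f \<gamma>)"
    using v by (simp add: sum.remove)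
  moreover have "(\<Sum>\<gamma>\<in>out ?v i j. ?f \<gamma>) \<approx> (if i = j then word [Vert ?v] else 0)"
    using relation_congr[OF wlpa_relations.edge_ghost[OF v assms(3) _ assms(5)]] assms(4,6)
    unfolding sum_edge_mult_ghost[OF v(1)] weight by blast
  ultimately have "?f \<alpha> + (\<Sum>\<gamma>\<in>out ?v i j - {\<alpha>}. ?f \<gamma>)
      \<approx> (if i = j then word [Vert ?v] else 0)" by simp
  from congr_diff[OF this congr_refl, of "\<Sum>\<gamma>\<in>out ?v i j - {\<alpha>}. ?f \<gamma>"]
  show ?thesis unfolding add_diff_cancel_right' .
qed

lemma path_word_mult_pair:
  assumes "path_end (u, q) = letter_source E x" "x \<in> letters E \<omega>" "y \<in> letters E \<omega>"
  shows "word (path_word (u, q)) * word [x, y] \<approx> word (path_word (u, y # x # q))"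
proof -
  have "word (path_word (u, q)) * word [x, y] = word (path_word (u, q)) * word [x] * word [y]"
    by (simp add: word_mult_word)
  also have "\<dots> \<approx> word (path_word (u, x # q)) * word [y]"
    using assms by (intro congr_mult_right path_word_mult_push) auto
  also have "\<dots> = word (path_word (u, y # x # q))"
    by (simp add: word_mult_word)
  finally show ?thesis .
qed

section \<open>Spanning\<close>

abbreviation path_lin ::
    "('v \<times> ('v, 'e) letter list \<Rightarrow>\<^sub>0 'r) \<Rightarrow> (('v, 'e) letter list \<Rightarrow>\<^sub>0 'r)" where
  "path_lin \<equiv> lin (\<lambda>s. word (path_word s))"

text \<open>The counterpart in the algebra of the formula for the action. In the contracting case
  the last letter is detached, the resulting two-letter word is rewritten, and the new pairs are
  pushed back onto the path.\<close>

lemma path_word_mult_letter: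
  assumes s: "normal_state s" and x: "x \<in> letters E \<omega>"
  shows "word (path_word s) * word [x] \<approx> path_lin (append_letter x s)"
proof -
  obtain u l where ul: "s = (u, l)" by (cases s)
  consider "path_end s \<noteq> letter_source E x" | "path_end s = letter_source E x" "is_vert x"
    | "path_end s = letter_source E x" "\<not> is_vert x" "\<not> redex l x"
    | "path_end s = letter_source E x" "\<not> is_vert x" "redex l x" by blast
  then show ?thesis
  proof cases
    case 1
    then show ?thesis
      using path_word_mult_mismatch[OF s x] by (simp add: ul del: path_word.simps)
  next
    case 2
    then obtain v where "x = Vert v" "path_end s = v" by (cases x) auto
    then show ?thesis
      using path_word_mult_end[OF s] by (simp add: ul del: path_word.simps)
  next
    case 3
    then show ?thesis
      using path_word_mult_push[of u l x] x by (simp add: ul del: path_word.simps)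
  next
    case 4
    from 4(3) show ?thesis
    proof (cases rule: redexE)
      case (1 \<alpha> \<beta> q)
      let ?p = "path_word (u, q)"
      have norm: "normal_state (u, q)" and \<alpha>: "\<alpha> \<in> arcs E" "path_end (u, q) = head E \<alpha>"
        and \<beta>: "\<beta> \<in> arcs E" "tail E \<alpha> = tail E \<beta>"
        using s x 4(1) by (simp_all add: ul 1)
      have p: "set ?p \<subseteq> letters E \<omega>"
        using path_word_letters[OF norm] by blast
      have G: "Ghost \<alpha> 1 \<in> letters E \<omega>"
        using \<alpha>(1) weight_pos by simp
      \<comment> \<open>Detaching the ghost letter is only a congruence: if \<open>q\<close> is
        empty, the vertex letter of the trivial path appears in front.\<close>
      have "word (path_word s) * word [x] \<approx> word ?p * word [Ghost \<alpha> 1] * word [x]"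
        unfolding ul 1(1) using \<alpha> G x
        by (intro congr_mult_right congr_sym[OF path_word_mult_push]) auto
      also have "\<dots> = word ?p * word [Ghost \<alpha> 1, Edge \<beta> 1]"
        by (simp add: word_mult_word 1(2) del: path_word.simps)
      also have "\<dots> \<approx> word ?p * ((if \<alpha> = \<beta> then word [Vert (head E \<alpha>)] else 0)
          - (\<Sum>k = 2..min (\<omega> \<alpha>) (\<omega> \<beta>). word [Ghost \<alpha> k, Edge \<beta> k]))"
        by (rule congr_word_mult[OF ghost_edge_congr[OF \<alpha>(1) \<beta>(1)] p])
      also have "\<dots> = (if \<alpha> = \<beta> then word ?p * word [Vert (head E \<alpha>)] else 0)
          - (\<Sum>k = 2..min (\<omega> \<alpha>) (\<omega> \<beta>). word ?p * word [Ghost \<alpha> k, Edge \<beta> k])"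
        by (simp add: right_diff_distrib sum_distrib_left del: path_word.simps)
      also have "\<dots> \<approx> (if \<alpha> = \<beta> then word ?p else 0)
          - (\<Sum>k = 2..min (\<omega> \<alpha>) (\<omega> \<beta>). word (path_word (u, Edge \<beta> k # Ghost \<alpha> k # q)))"
        using \<alpha> \<beta> path_word_mult_end[OF norm]
        by (intro congr_diff congr_sum path_word_mult_pair) (auto simp del: path_word.simps)
      also have "\<dots> = path_lin (append_letter x s)"
        using 4(1) \<beta>(2) by (simp add: ul 1 lin_diff lin_sum lin_uminus del: path_word.simps)
      finally show ?thesis .
    next
      case (2 \<alpha> i j q)
      let ?p = "path_word (u, q)" and ?v = "tail E \<alpha>"
      have norm: "normal_state (u, q)" and \<alpha>: "\<alpha> \<in> arcs E" "path_end (u, q) = ?v"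
        and ij: "1 \<le> i" "i \<le> \<omega> \<alpha>" "1 \<le> j" "j \<le> \<omega> \<alpha>"
        using s x by (simp_all add: ul 2(1,2))
      have p: "set ?p \<subseteq> letters E \<omega>"
        using path_word_letters[OF norm] by blast
      have G: "Edge \<alpha> i \<in> letters E \<omega>"
        using \<alpha>(1) ij by simp
      have "word (path_word s) * word [x] \<approx> word ?p * word [Edge \<alpha> i] * word [x]"
        unfolding ul 2(1) using \<alpha> G x
        by (intro congr_mult_right congr_sym[OF path_word_mult_push]) auto
      also have "\<dots> = word ?p * word [Edge \<alpha> i, Ghost \<alpha> j]"
        by (simp add: word_mult_word 2(2) del: path_word.simps)
      also have "\<dots> \<approx> word ?p * ((if i = j then word [Vert ?v] else 0)
          - (\<Sum>\<gamma>\<in>out ?v i j - {\<alpha>}. word [Edge \<gamma> i, Ghost \<gamma> j]))"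
        by (rule congr_word_mult[OF edge_ghost_congr[OF \<alpha>(1) 2(3) ij] p])
      also have "\<dots> = (if i = j then word ?p * word [Vert ?v] else 0)
          - (\<Sum>\<gamma>\<in>out ?v i j - {\<alpha>}. word ?p * word [Edge \<gamma> i, Ghost \<gamma> j])"
        by (simp add: right_diff_distrib sum_distrib_left del: path_word.simps)
      also have "\<dots> \<approx> (if i = j then word ?p else 0)
          - (\<Sum>\<gamma>\<in>out ?v i j - {\<alpha>}. word (path_word (u, Ghost \<gamma> j # Edge \<gamma> i # q)))"
        using \<alpha> ij path_word_mult_end[OF norm]
        by (intro congr_diff congr_sum path_word_mult_pair) (auto simp: out_def simp del: path_word.simps)
      also have "\<dots> = path_lin (append_letter x s)"
        using 4(1) 2(3) by (simp add: ul 2(1,2) lin_diff lin_sum lin_uminus del: path_word.simps)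
      finally show ?thesis .
    qed
  qed
qed

lemma word_congr_path_lin:
  assumes "w \<noteq> []" "set w \<subseteq> letters E \<omega>"
  obtains v where "normal_span v" "word w \<approx> path_lin v"
proof -
  have "\<exists>v. normal_span v \<and> word w \<approx> path_lin v"
    using assms
  proof (induction w rule: rev_nonempty_induct)
    case (single x)
    let ?s = "if is_vert x then (letter_source E x, []) else (letter_source E x, [x])"
    have "normal_state ?s"
      using single letter_source_verts[of x] by (cases x) auto
    moreover have "path_word ?s = [x]" by (cases x) auto
    ultimately show ?case
      by (intro exI[of _ "basis ?s"]) (simp add: normal_span_basis)
  next
    case (snoc x w)
    then obtain v where v: "normal_span v" "word w \<approx> path_lin v" by auto
    have x: "x \<in> letters E \<omega>" using snoc by simp
    have "word (w @ [x]) = word w * word [x]" by (simp add: word_mult_word)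
    also have "\<dots> \<approx> path_lin v * word [x]"
      using v(2) x by (intro congr_mult_right) simp_all
    also have "\<dots> = lin (\<lambda>s. word (path_word s) * word [x]) v"
      by (rule lin_mult_const)
    also have "\<dots> \<approx> lin (\<lambda>s. path_lin (append_letter x s)) v"
      using v(1) x by (intro congr_lin path_word_mult_letter) (auto simp: normal_span_def)
    also have "\<dots> = path_lin (lin (append_letter x) v)"
      by (simp only: lin_lin)
    finally have "word (w @ [x]) \<approx> path_lin (lin (append_letter x) v)" .
    moreover have "normal_span (lin (append_letter x) v)"
      using v(1) x by (intro normal_span_lin normal_span_append_letter)
    ultimately show ?case by blast
  qed
  then show ?thesis using that by blast
qed

lemma spanning:
  assumes f: "f \<in> carrier A"
  obtains v where "\<forall>s\<in>Poly_Mapping.keys v. normal_state s" "f \<approx> path_lin v"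
proof -
  have "\<exists>v. normal_span v \<and> word w \<approx> path_lin v" if "w \<in> Poly_Mapping.keys f" for w
    using word_congr_path_lin free_carrierD[OF f that] by blast
  then obtain V where V: "normal_span (V w)" "word w \<approx> path_lin (V w)"
    if "w \<in> Poly_Mapping.keys f" for w
    by metis
  have "f = lin word f"
    using lin_single_one[of f] by (simp add: word_def[abs_def])
  also have "lin word f \<approx> lin (\<lambda>w. path_lin (V w)) f"
    using V(2) by (rule congr_lin)
  also have "\<dots> = path_lin (lin V f)"
    by (simp only: lin_lin)
  finally have "f \<approx> path_lin (lin V f)" .
  \<comment> \<open>The coefficients of \<open>f\<close> are arbitrary, so \<open>lin V f\<close>
    need not be central; only the support condition of \<open>normal_span\<close> carries
    over.\<close>
  moreover have "Poly_Mapping.keys (lin V f) \<subseteq> (\<Union>w\<in>Poly_Mapping.keys f. Poly_Mapping.keys (V w))"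
    unfolding lin_def by (rule order_trans[OF keys_sum_subset UN_mono]) (simp_all add: keys_lscale)
  ultimately show ?thesis
    using that V(1) unfolding normal_span_def by blast
qed

section \<open>Linear independence and the basis\<close>

lemma independent:
  assumes T: "finite T" "\<And>p. p \<in> T \<Longrightarrow> normal_path E \<omega> sel p"
    and sum: "(\<Sum>p\<in>T. lscale (c p) (word p)) \<in> (wlpa_ideal E \<omega> :: (_ \<Rightarrow>\<^sub>0 'r) set)" and p: "p \<in> T"
  shows "c p = 0"
proof -
  obtain u l where ul: "normal_state (u, l)" "p = path_word (u, l)"
    using normal_pathE[OF T(2)[OF p]] by (metis prod.exhaust)
  \<comment> \<open>Acting on the start vertex of \<open>p\<close> kills the paths that start
    elsewhere and sends the others to distinct basis vectors, so the coefficient at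
    \<open>(u, l)\<close> isolates \<open>c p\<close>.\<close>
  let ?g = "\<lambda>w. act w (basis (u, [])) :: _ \<Rightarrow>\<^sub>0 'r"
  have coeff: "Poly_Mapping.lookup (?g q) (u, l) = (if q = p then 1 else 0)" if "q \<in> T" for q
  proof -
    obtain v m where vm: "normal_state (v, m)" "q = path_word (v, m)"
      using normal_pathE[OF T(2)[OF \<open>q \<in> T\<close>]] by (metis prod.exhaust)
    have "q = p \<longleftrightarrow> (v, m) = (u, l)"
      using path_word_inj[OF vm(1) ul(1)] vm(2) ul(2) by auto
    moreover have "?g q = (if u = v then basis (v, m) else 0)"
      unfolding vm(2) by (rule act_path_word[OF vm(1)])
    ultimately show ?thesis
      by (auto simp: lookup_single when_def)
  qed
  have "normal_state (u, [])"
    using normal_state_start[OF ul(1)] by simp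
  then have "lin ?g (\<Sum>p\<in>T. lscale (c p) (word p)) = 0"
    using annihilatorD(2) sum wlpa_ideal_annihilator by blast
  then have "(\<Sum>q\<in>T. lscale (c q) (?g q)) = 0"
    by (simp add: lin_sum lin_lscale)
  from arg_cong[OF this, of "\<lambda>f. Poly_Mapping.lookup f (u, l)"]
  have "(\<Sum>q\<in>T. c q * Poly_Mapping.lookup (?g q) (u, l)) = 0"
    by (simp add: lookup_sum)
  moreover have "(\<Sum>q\<in>T. c q * Poly_Mapping.lookup (?g q) (u, l)) = (\<Sum>q\<in>T. if q = p then c q else 0)"
    by (rule sum.cong) (simp_all add: coeff)
  ultimately show ?thesis
    using T(1) p by simp
qed

lemma left_basis_normal_paths:
  "left_basis M {p. normal_path E \<omega> sel p} (\<lambda>p. coset (word p))"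
  unfolding left_basis_def
proof (intro conjI ballI allI impI)
  have carrier: "word p \<in> carrier A" if "normal_path E \<omega> sel p" for p
    using normal_pathE[OF that] path_word_letters by (metis free_carrier_word)
  then show "(\<lambda>p. coset (word p)) ` {p. normal_path E \<omega> sel p} \<subseteq> carrier M"
    by (auto simp: carrier_quotient)
  have lincomb: "(\<Oplus>\<^bsub>M\<^esub>p\<in>T. c p \<odot>\<^bsub>M\<^esub> coset (word p)) = coset (\<Sum>p\<in>T. lscale (c p) (word p))"
    if "finite T" "T \<subseteq> {p. normal_path E \<omega> sel p}" for T c
    unfolding smult_quotient using that carrier by (intro finsum_quotient) auto
  {
    fix m assume "m \<in> carrier M"
    then obtain f where f: "f \<in> carrier A" "m = coset f"
      by (auto simp: carrier_quotient)
    obtain v where v: "\<forall>s\<in>Poly_Mapping.keys v. normal_state s" "f \<approx> path_lin v"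
      using spanning[OF f(1)] .
    \<comment> \<open>The vector \<open>v\<close> is indexed by states and the basis by words; the
      inverse of \<open>path_word\<close> on the support transports the coefficients.\<close>
    let ?S = "Poly_Mapping.keys v" and ?inv = "inv_into (Poly_Mapping.keys v) path_word"
    have inj: "inj_on path_word ?S"
      using v(1) by (intro inj_onI path_word_inj) blast+
    have "path_lin v = (\<Sum>p\<in>path_word ` ?S. lscale (Poly_Mapping.lookup v (?inv p)) (word p))"
      unfolding lin_def using inj by (simp add: sum.reindex del: path_word.simps)
    moreover have T: "finite (path_word ` ?S)" "path_word ` ?S \<subseteq> {p. normal_path E \<omega> sel p}"
      using v(1) normal_path_path_word by auto
    ultimately have "m = (\<Oplus>\<^bsub>M\<^esub>p\<in>path_word ` ?S. Poly_Mapping.lookup v (?inv p) \<odot>\<^bsub>M\<^esub> coset (word p))"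
      using f(2) v(2) by (simp add: lincomb coset_eq_iff congr_def)
    then show "\<exists>T c. finite T \<and> T \<subseteq> {p. normal_path E \<omega> sel p}
        \<and> m = (\<Oplus>\<^bsub>M\<^esub>p\<in>T. c p \<odot>\<^bsub>M\<^esub> coset (word p))"
      using T by (intro exI[of _ "path_word ` ?S"] exI[of _ "\<lambda>p. Poly_Mapping.lookup v (?inv p)"] conjI)
  }
  fix T c p
  assume *: "finite T \<and> T \<subseteq> {p. normal_path E \<omega> sel p}
      \<and> (\<Oplus>\<^bsub>M\<^esub>p\<in>T. c p \<odot>\<^bsub>M\<^esub> coset (word p)) = \<zero>\<^bsub>M\<^esub>" and "p \<in> T"
  then have "coset (\<Sum>p\<in>T. lscale (c p) (word p)) = coset 0"
    using lincomb[of T c] by (simp add: zero_quotient)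
  then show "c p = 0"
    using * \<open>p \<in> T\<close> by (intro independent[of T]) (auto simp: coset_eq_iff)
qed

end

theorem theorem16:
  fixes E :: "('v, 'e) pre_digraph" and \<omega> :: "'e \<Rightarrow> nat" and sel :: "'v \<Rightarrow> 'e"
  assumes "row_finite_weighted_graph E \<omega>"
    and "\<And>v. v \<in> verts E \<Longrightarrow> \<not> sink E v \<Longrightarrow>
           sel v \<in> arcs E \<and> tail E (sel v) = v \<and> \<omega> (sel v) = vertex_weight E \<omega> v"
  shows "left_basis (wlpa E \<omega> :: ('r::{ring,monoid_mult}, _) bimodule_ring)
           {p. normal_path E \<omega> sel p} (\<lambda>p. wlpa_class E \<omega> (word p))"
proof -
  interpret row_finite_weighted_graph E \<omega> by (rule assms(1))
  interpret weighted_leavitt E \<omega> sel "TYPE('r)"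
    by unfold_locales (rule assms(2))
  show ?thesis
    unfolding wlpa_def wlpa_class_def by (rule left_basis_normal_paths)
qed

end
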